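(* Let $G$ be a finite group and $n$ a positive integer. The $\mathbb{Z}$-module map $f:(\mathbb{Z}\Sigma_n^G)^{S_n}\to\mathbb{Z}[G\wr S_n]$ defined on the basis $(\sigma_\alpha)$, indexed by the $G$-compositions $\alpha$ of $n$, by $f(\sigma_\alpha)=X_\alpha$ is an injective anti-homomorphism of algebras (so that $f(xy)=f(y)*f(x)$ for all $x,y\in(\mathbb{Z}\Sigma_n^G)^{S_n}$).
   Context: Let $e$ be the identity of $G$ and $[n]=\{1,\dots,n\}$. **The semigroup $\Sigma_n^G$.** An ordered partition of $[n]$ is a tuple $(B_1,\dots,B_k)$ of nonempty pairwise disjoint sets with union $[n]$. An ordered $G$-partition of $[n]$ is a tuple $((B_1,g_1),\dots,(B_k,g_k))$ such that $(B_1,\dots,B_k)$ is an ordered partition of $[n]$ and $g_i\in G$ for all $i$. $\Sigma_n^G$ is the set of ordered $G$-partitions of $[n]$, with the product of $((B_1,g_1),\dots,(B_k,g_k))$ and $((C_1,h_1),\dots,(C_\ell,h_\ell))$ (in this order) being the tuple of pairs $(B_i\cap C_j,\,h_jg_i)$, listed in lexicographic order of $(i,j)\in[k]\times[\ell]$ (all $j$ for $i=1$ first, then all $j$ for $i=2$, etc.), with pairs for which $B_i\cap C_j=\emptyset$ omitted. This makes $\Sigma_n^G$ a semigroup with identity $(([n],e))$. $\mathbb{Z}\Sigma_n^G$ is its semigroup algebra over $\mathbb{Z}$. **The invariant subalgebra.** The symmetric group $S_n$ acts on $\Sigma_n^G$ by $\pi\cdot((B_1,g_1),\dots,(B_k,g_k))=((\pi(B_1),g_1),\dots,(\pi(B_k),g_k))$,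 extended linearly to $\mathbb{Z}\Sigma_n^G$; $(\mathbb{Z}\Sigma_n^G)^{S_n}$ is the subalgebra of elements $P$ with $\pi\cdot P=P$ for all $\pi\in S_n$. A $G$-composition of $n$ is a sequence $((a_1,g_1),\dots,(a_k,g_k))$ with $a_i$ positive integers summing to $n$ and $g_i\in G$. The type of an ordered $G$-partition $((B_1,g_1),\dots,(B_k,g_k))$ is the $G$-composition $((|B_1|,g_1),\dots,(|B_k|,g_k))$. For a $G$-composition $\alpha$ of $n$, $\sigma_\alpha=\sum P$, the sum over all $P\in\Sigma_n^G$ of type $\alpha$. The $\sigma_\alpha$ form a $\mathbb{Z}$-basis of $(\mathbb{Z}\Sigma_n^G)^{S_n}$. **The wreath product.** $G\wr S_n$ is the set $S_n\times G^{[n]}$, where $G^{[n]}$ is the set of functions $[n]\to G$; $(\pi,g)$ is written $((\pi_1,g_1),\dots,(\pi_n,g_n))$ with $\pi_i=\pi(i)$, $g_i=g(i)$. The group operation is $$((\pi_1,g_1),\dots,(\pi_n,g_n))*((\tau_1,h_1),\dots,(\tau_n,h_n))=((\pi_{\tau_1},g_{\tau_1}h_1),\dots,(\pi_{\tau_n},g_{\tau_n}h_n)).$$ $\mathbb{Z}[G\wr S_n]$ is its group algebra, with product also denoted $*$. **The elements $X_\alpha$.** For $u=((\pi_1,g_1),\dots,(\pi_n,g_n))\in G\wr S_n$, $\mathrm{Co}(u)$ is the unique $G$-composition $((a_1,h_1),\dots,(a_k,h_k))$ of $n$ with $k$ as small as possible such that, for each $r\in[k]$, writing $s_r=a_1+\cdots+a_{r-1}$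 (so $s_1=0$), one has $\pi_{s_r+1}<\pi_{s_r+2}<\cdots<\pi_{s_r+a_r}$ and $g_{s_r+1}=\cdots=g_{s_r+a_r}=h_r$. For a $G$-composition $\alpha$ of $n$, $Y_\alpha=\sum u$, the sum over all $u\in G\wr S_n$ with $\mathrm{Co}(u)=\alpha$. The set of $G$-compositions of $n$ is partially ordered by the relation generated by the cover relations $$((a_1,g_1),\dots,(a+b,g_i),\dots,(a_k,g_k))<((a_1,g_1),\dots,(a,g_i),(b,g_i),\dots,(a_k,g_k))$$ with $a,b$ positive integers; i.e. $\alpha\le\beta$ iff $\beta$ is a color-preserving refinement of $\alpha$. Then $X_\alpha=\sum_{\beta\le\alpha}Y_\beta$, the sum over $G$-compositions $\beta$ of $n$ with $\beta\le\alpha$. *)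

theory Defs
  imports
    "HOL-Algebra.Algebra"
    "HOL-Library.Poly_Mapping"
    "HOL-Library.Disjoint_Sets"
    "HOL-Combinatorics.Permutations"
begin

section \<open>Integral monoid algebras\<close>

text \<open>The algebra \<open>\<int>M\<close>, where \<open>frag_of a\<close> is the basis element belonging to \<open>a \<in> carrier M\<close>.\<close>

definition int_algebra :: "('a, 'm) monoid_scheme \<Rightarrow> ('a \<Rightarrow>\<^sub>0 int) ring" where
  "int_algebra M =
     \<lparr>carrier = {x. Poly_Mapping.keys x \<subseteq> carrier M},
      monoid.mult = (\<lambda>x y. frag_extend (\<lambda>a. frag_extend (\<lambda>b. frag_of (a \<otimes>\<^bsub>M\<^esub> b)) y) x),
      one = frag_of \<one>\<^bsub>M\<^esub>,
      ring.zero = 0,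
      ring.add = (+)\<rparr>"

definition ring_anti_hom ::
  "('a, 'm) ring_scheme \<Rightarrow> ('b, 'k) ring_scheme \<Rightarrow> ('a \<Rightarrow> 'b) set" where
  "ring_anti_hom R S =
     {h. h \<in> carrier R \<rightarrow> carrier S \<and>
         (\<forall>x y. x \<in> carrier R \<and> y \<in> carrier R \<longrightarrow>
            h (x \<otimes>\<^bsub>R\<^esub> y) = h y \<otimes>\<^bsub>S\<^esub> h x \<and> h (x \<oplus>\<^bsub>R\<^esub> y) = h x \<oplus>\<^bsub>S\<^esub> h y) \<and>
         h \<one>\<^bsub>R\<^esub> = \<one>\<^bsub>S\<^esub>}"


section \<open>The monoid of ordered \<open>G\<close>-partitions\<close>

definition ordered_G_partitions ::
  "('g, 'm) monoid_scheme \<Rightarrow> nat \<Rightarrow> (nat set \<times> 'g) list set" where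
  "ordered_G_partitions G n =
     {P. distinct (map fst P) \<and> partition_on {1..n} (set (map fst P)) \<and>
         set (map snd P) \<subseteq> carrier G}"

text \<open>The group elements are multiplied in the order opposite to that of the factors.\<close>

definition G_partition_mult ::
  "('g, 'm) monoid_scheme \<Rightarrow>
     (nat set \<times> 'g) list \<Rightarrow> (nat set \<times> 'g) list \<Rightarrow> (nat set \<times> 'g) list" where
  "G_partition_mult G P Q =
     [(B \<inter> C, h \<otimes>\<^bsub>G\<^esub> g). (B, g) \<leftarrow> P, (C, h) \<leftarrow> Q, B \<inter> C \<noteq> {}]"

definition G_partition_monoid ::
  "('g, 'm) monoid_scheme \<Rightarrow> nat \<Rightarrow> (nat set \<times> 'g) list monoid" where
  "G_partition_monoid G n =
     \<lparr>carrier = ordered_G_partitions G n,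
      monoid.mult = G_partition_mult G,
      one = [({1..n}, \<one>\<^bsub>G\<^esub>)]\<rparr>"

definition G_partition_act ::
  "(nat \<Rightarrow> nat) \<Rightarrow> (nat set \<times> 'g) list \<Rightarrow> (nat set \<times> 'g) list" where
  "G_partition_act \<pi> P = map (\<lambda>(B, g). (\<pi> ` B, g)) P"

definition invariant_algebra ::
  "('g, 'm) monoid_scheme \<Rightarrow> nat \<Rightarrow> ((nat set \<times> 'g) list \<Rightarrow>\<^sub>0 int) ring" where
  "invariant_algebra G n =
     (int_algebra (G_partition_monoid G n))
       \<lparr>carrier := {x \<in> carrier (int_algebra (G_partition_monoid G n)).
          \<forall>\<pi>. \<pi> permutes {1..n} \<longrightarrow> frag_extend (\<lambda>P. frag_of (G_partition_act \<pi> P)) x = x}\<rparr>"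


section \<open>\<open>G\<close>-compositions\<close>

definition G_compositions ::
  "('g, 'm) monoid_scheme \<Rightarrow> nat \<Rightarrow> (nat \<times> 'g) list set" where
  "G_compositions G n =
     {\<alpha>. (\<forall>(a, g) \<in> set \<alpha>. a > 0 \<and> g \<in> carrier G) \<and> sum_list (map fst \<alpha>) = n}"

definition G_partition_type :: "(nat set \<times> 'g) list \<Rightarrow> (nat \<times> 'g) list" where
  "G_partition_type P = map (\<lambda>(B, g). (card B, g)) P"

definition sigma_elem ::
  "('g, 'm) monoid_scheme \<Rightarrow> nat \<Rightarrow> (nat \<times> 'g) list \<Rightarrow> ((nat set \<times> 'g) list \<Rightarrow>\<^sub>0 int)" where
  "sigma_elem G n \<alpha> = (\<Sum>P \<in> {P \<in> ordered_G_partitions G n. G_partition_type P = \<alpha>}. frag_of P)"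

inductive G_comp_cover :: "(nat \<times> 'g) list \<Rightarrow> (nat \<times> 'g) list \<Rightarrow> bool" where
  "a > 0 \<Longrightarrow> b > 0 \<Longrightarrow>
     G_comp_cover (\<alpha> @ [(a + b, g)] @ \<beta>) (\<alpha> @ [(a, g), (b, g)] @ \<beta>)"

definition G_comp_le :: "(nat \<times> 'g) list \<Rightarrow> (nat \<times> 'g) list \<Rightarrow> bool" where
  "G_comp_le = G_comp_cover\<^sup>*\<^sup>*"


section \<open>The wreath product\<close>

definition wreath_product ::
  "('g, 'm) monoid_scheme \<Rightarrow> nat \<Rightarrow> ((nat \<Rightarrow> nat) \<times> (nat \<Rightarrow> 'g)) monoid" where
  "wreath_product G n =
     \<lparr>carrier = {\<pi>. \<pi> permutes {1..n}} \<times> ({1..n} \<rightarrow>\<^sub>E carrier G),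
      monoid.mult = (\<lambda>(\<pi>, g) (\<tau>, h). (\<pi> \<circ> \<tau>, \<lambda>i\<in>{1..n}. g (\<tau> i) \<otimes>\<^bsub>G\<^esub> h i)),
      one = (id, \<lambda>i\<in>{1..n}. \<one>\<^bsub>G\<^esub>)\<rparr>"

text \<open>
  \<open>G_comp_fits u \<alpha>\<close>: cutting the word \<open>(\<pi> 1, g 1), \<dots>, (\<pi> n, g n)\<close> into consecutive
  segments of the lengths listed in \<open>\<alpha>\<close>, the first components increase strictly along
  each segment and the second components are all equal to the colour listed in \<open>\<alpha>\<close>.
  List positions start at 0, letters of the word at 1.
\<close>

definition G_comp_fits ::
  "(nat \<Rightarrow> nat) \<times> (nat \<Rightarrow> 'g) \<Rightarrow> (nat \<times> 'g) list \<Rightarrow> bool" where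
  "G_comp_fits u \<alpha> \<longleftrightarrow>
     (\<forall>r < length \<alpha>.
        let s = sum_list (map fst (take r \<alpha>)); I = {s + 1..s + fst (\<alpha> ! r)}
        in strict_mono_on I (fst u) \<and> (\<forall>i\<in>I. snd u i = snd (\<alpha> ! r)))"

definition Co ::
  "('g, 'm) monoid_scheme \<Rightarrow> nat \<Rightarrow> (nat \<Rightarrow> nat) \<times> (nat \<Rightarrow> 'g) \<Rightarrow> (nat \<times> 'g) list" where
  "Co G n u = (THE \<alpha>. is_arg_min length (\<lambda>\<alpha>. \<alpha> \<in> G_compositions G n \<and> G_comp_fits u \<alpha>) \<alpha>)"

definition Y_elem ::
  "('g, 'm) monoid_scheme \<Rightarrow> nat \<Rightarrow> (nat \<times> 'g) list \<Rightarrow>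
     ((nat \<Rightarrow> nat) \<times> (nat \<Rightarrow> 'g) \<Rightarrow>\<^sub>0 int)" where
  "Y_elem G n \<alpha> = (\<Sum>u \<in> {u \<in> carrier (wreath_product G n). Co G n u = \<alpha>}. frag_of u)"

definition X_elem ::
  "('g, 'm) monoid_scheme \<Rightarrow> nat \<Rightarrow> (nat \<times> 'g) list \<Rightarrow>
     ((nat \<Rightarrow> nat) \<times> (nat \<Rightarrow> 'g) \<Rightarrow>\<^sub>0 int)" where
  "X_elem G n \<alpha> = (\<Sum>\<beta> \<in> {\<beta> \<in> G_compositions G n. G_comp_le \<beta> \<alpha>}. Y_elem G n \<beta>)"


section \<open>The \<open>\<int>\<close>-module map sending \<open>\<sigma>\<^sub>\<alpha>\<close> to \<open>X\<^sub>\<alpha>\<close>\<close>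

text \<open>
  The \<open>\<int>\<close>-module maps are the homomorphisms of additive groups; extensionality only
  fixes the irrelevant values outside the domain.
\<close>

definition sigma_to_X_maps ::
  "('g, 'm) monoid_scheme \<Rightarrow> nat \<Rightarrow>
     (((nat set \<times> 'g) list \<Rightarrow>\<^sub>0 int) \<Rightarrow> ((nat \<Rightarrow> nat) \<times> (nat \<Rightarrow> 'g) \<Rightarrow>\<^sub>0 int)) set" where
  "sigma_to_X_maps G n =
     {f. f \<in> extensional (carrier (invariant_algebra G n)) \<and>
         f \<in> hom (add_monoid (invariant_algebra G n)) (add_monoid (int_algebra (wreath_product G n))) \<and>
         (\<forall>\<alpha> \<in> G_compositions G n. f (sigma_elem G n \<alpha>) = X_elem G n \<alpha>)}"

end

theory Submission
  imports Defs
begin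

text \<open>
  The map is evaluation at a chamber. Ordered \<open>G\<close>-partitions into singletons, the chambers,
  form a left ideal of the monoid of ordered \<open>G\<close>-partitions, and listing
  their letters and colours identifies them with the elements of the wreath product. Thus the
  monoid acts on the wreath product from the left. Let \<open>e\<close> be the identity chamber. The
  product \<open>P e\<close> lists the blocks of \<open>P\<close> one after the other, each in increasing order
  and in the colour of the block. Therefore \<open>P \<mapsto> P e\<close> is a bijection from the partitions of
  type \<open>\<alpha>\<close> onto the elements whose word, cut into segments as \<open>\<alpha>\<close> prescribes, increases
  with constant colour on each segment (\<open>bij_betw_chamber_act_one\<close>). The compositions
  that a word fits in this sense are the refinements of its greedy composition
  (\<open>run_composition_le_iff\<close>), so the sum of these elements is \<open>X\<^sub>\<alpha>\<close>. Hence
  \<open>x \<mapsto> x e\<close> sends \<open>\<sigma>\<^sub>\<alpha>\<close> to \<open>X\<^sub>\<alpha>\<close>.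

  The monoid action moves positions and multiplies colours from the right; left
  multiplication by an element \<open>v\<close> of the wreath product renames letters and multiplies
  colours from the left. Up to the renaming of letters in the blocks of the
  partitions the two commute (\<open>chamber_act_equivariant\<close>), and an invariant element \<open>x\<close>
  does not notice the renaming: \<open>x (v * c) = v * (x c)\<close>. Applied to the terms
  \<open>v = v * e\<close> of \<open>y e\<close>, this gives \<open>(x y) e = x (y e) = (y e) * (x e)\<close>,
  which is the anti-homomorphism property (\<open>to_wreath_mult\<close>).

  Injectivity is triangularity (\<open>to_wreath_eq_0\<close>): for each \<open>\<alpha>\<close> some element \<open>u\<close> has
  \<open>\<alpha>\<close> as its greedy composition, and \<open>u\<close> occurs in \<open>X\<^sub>\<beta>\<close> only if \<open>\<beta>\<close>
  refines \<open>\<alpha>\<close>. Uniqueness of the map holds because the symmetric group is transitive on the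
  partitions of each type, so the \<open>\<sigma>\<^sub>\<alpha>\<close> span the invariants.
\<close>

section \<open>Words and the compositions they fit\<close>

text \<open>
  The recursive form of \<^const>\<open>G_comp_fits\<close> for an element of the wreath product that is
  written out as its word of pairs (value, colour).
\<close>

fun fits_word :: "(nat \<times> 'g) list \<Rightarrow> (nat \<times> 'g) list \<Rightarrow> bool" where
  "fits_word w [] \<longleftrightarrow> True"
| "fits_word w ((a, g) # \<alpha>) \<longleftrightarrow>
     sorted_wrt (<) (map fst (take a w)) \<and> (\<forall>x \<in> set (take a w). snd x = g) \<and>
     fits_word (drop a w) \<alpha>"

text \<open>
  The greedy decomposition into maximal increasing runs of a single colour; on the words of
  the wreath product this is \<^const>\<open>Co\<close>.
\<close>

fun run_composition :: "(nat \<times> 'g) list \<Rightarrow> (nat \<times> 'g) list" where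
  "run_composition [] = []"
| "run_composition (x # w) =
     (case run_composition w of
        [] \<Rightarrow> [(1, snd x)]
      | (a, g) # \<alpha> \<Rightarrow>
          if snd x = g \<and> fst x < fst (hd w) then (Suc a, g) # \<alpha> else (1, snd x) # (a, g) # \<alpha>)"

lemma run_composition_eq_Nil_iff [simp]: "run_composition w = [] \<longleftrightarrow> w = []"
  by (cases w) (auto split: list.splits)

lemma run_composition_Cons:
  assumes "run_composition w = (a, g) # \<alpha>"
  shows "run_composition (x # w) =
    (if snd x = g \<and> fst x < fst (hd w) then (Suc a, g) # \<alpha> else (1, snd x) # (a, g) # \<alpha>)"
  using assms by simp

lemma run_composition_ConsD:
  assumes "run_composition w = (a, g) # \<alpha>"
  shows "w \<noteq> []" "snd (hd w) = g" "a > 0"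
proof -
  show "w \<noteq> []" using assms by auto
  then show "snd (hd w) = g" "a > 0"
    using assms by (cases w; auto split: list.splits if_splits)+
qed

lemma sum_run_composition: "sum_list (map fst (run_composition w)) = length w"
  by (induction w) (auto split: list.splits)

lemma run_composition_entries:
  "(a, g) \<in> set (run_composition w) \<Longrightarrow> a > 0 \<and> g \<in> snd ` set w"
proof (induction w arbitrary: a g)
  case Nil
  then show ?case by simp
next
  case (Cons x w)
  show ?case
  proof (cases "run_composition w")
    case Nil
    then show ?thesis using Cons.prems by simp
  next
    case (Cons p \<alpha>)
    obtain b h where p: "p = (b, h)" by (cases p)
    have "h \<in> snd ` set w" using Cons.IH[of b h] Cons p by simp
    then show ?thesis
      using Cons.prems Cons.IH[of a g] Cons p
      unfolding run_composition_Cons[OF Cons[unfolded p]] by (auto split: if_splits)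
  qed
qed

lemma fits_run_composition: "fits_word w (run_composition w)"
proof (induction w)
  case Nil
  then show ?case by simp
next
  case (Cons x w)
  show ?case
  proof (cases "run_composition w")
    case Nil
    then show ?thesis by simp
  next
    case (Cons p \<alpha>)
    obtain a g where p: "p = (a, g)" by (cases p)
    note rc = Cons[unfolded p]
    note D = run_composition_ConsD[OF rc]
    then obtain a' y w' where w: "w = y # w'" and a: "a = Suc a'"
      by (cases w; cases a) auto
    show ?thesis
      using Cons.IH rc D unfolding w a by (auto split: if_splits)
  qed
qed

lemma G_comp_le_Cons:
  assumes "G_comp_le \<alpha> \<beta>" shows "G_comp_le (x # \<alpha>) (x # \<beta>)"
  using assms unfolding G_comp_le_def
proof (induction rule: rtranclp_induct)
  case base
  then show ?case by simp
next
  case (step \<beta> \<gamma>)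
  from step.hyps(2) have "G_comp_cover (x # \<beta>) (x # \<gamma>)"
  proof cases
    case (1 a b \<alpha>' g \<beta>')
    then show ?thesis
      using G_comp_cover.intros[of a b "x # \<alpha>'" g \<beta>'] by simp
  qed
  with step.IH show ?case by (rule rtranclp.rtrancl_into_rtrancl)
qed

text \<open>
  A refinement stays a refinement when the same letter is added to the first part of both
  sides; this is the step in which a letter joins the run to its right.
\<close>

lemma G_comp_le_enlarge_head:
  assumes "G_comp_le ((a, g) # \<alpha>) \<beta>"
  shows "\<exists>b \<beta>'. \<beta> = (b, g) # \<beta>' \<and> G_comp_le ((Suc a, g) # \<alpha>) ((Suc b, g) # \<beta>')"
  using assms unfolding G_comp_le_def
proof (induction rule: rtranclp_induct)
  case base
  then show ?case by simp
next
  case (step \<beta> \<gamma>)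
  then obtain b \<beta>' where \<beta>: "\<beta> = (b, g) # \<beta>'"
    and le: "G_comp_cover\<^sup>*\<^sup>* ((Suc a, g) # \<alpha>) ((Suc b, g) # \<beta>')" by blast
  from step.hyps(2) show ?case
  proof cases
    case (1 c d \<delta> h \<epsilon>)
    show ?thesis
    proof (cases \<delta>)
      case Nil
      then have "G_comp_cover ((Suc b, g) # \<beta>') ((Suc c, g) # (d, g) # \<epsilon>)"
        using 1 \<beta> G_comp_cover.intros[of "Suc c" d "[]" g \<epsilon>] by auto
      then show ?thesis using le 1 \<beta> Nil by (auto intro: rtranclp.rtrancl_into_rtrancl)
    next
      case (Cons p \<delta>')
      then have "G_comp_cover ((Suc b, g) # \<beta>') ((Suc b, g) # \<delta>' @ [(c, h), (d, h)] @ \<epsilon>)"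
        using 1 \<beta> G_comp_cover.intros[of c d "(Suc b, g) # \<delta>'" h \<epsilon>] by auto
      then show ?thesis using le 1 \<beta> Cons by (auto intro: rtranclp.rtrancl_into_rtrancl)
    qed
  qed
qed

lemma fits_word_cover:
  assumes "G_comp_cover \<alpha> \<beta>" and "fits_word w \<alpha>"
  shows "fits_word w \<beta>"
  using assms(1)
proof cases
  case (1 a b \<gamma> g \<delta>)
  have "fits_word w (\<gamma> @ [(a + b, g)] @ \<delta>) \<Longrightarrow> fits_word w (\<gamma> @ [(a, g), (b, g)] @ \<delta>)"
  proof (induction \<gamma> arbitrary: w)
    case Nil
    then show ?case
      by (auto simp: take_add sorted_wrt_append drop_drop add.commute)
  next
    case (Cons p \<gamma>)
    then show ?case by (cases p) auto
  qed
  then show ?thesis using assms(2) 1 by simp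
qed

lemma fits_word_mono:
  assumes "G_comp_le \<alpha> \<beta>" and "fits_word w \<alpha>"
  shows "fits_word w \<beta>"
  using assms unfolding G_comp_le_def
proof (induction rule: rtranclp_induct)
  case base
  then show ?case .
next
  case (step \<beta> \<gamma>)
  then show ?case using fits_word_cover by blast
qed

text \<open>
  Reading the word from the right, a new first letter either starts its own part of
  \<open>\<alpha>\<close>, and then the greedy composition can only be coarser there, or it belongs to the
  first part of \<open>\<alpha>\<close>, and then it extends the first greedy run as well.
\<close>

lemma run_composition_le:
  assumes "\<forall>x \<in> set \<alpha>. fst x > 0" and "sum_list (map fst \<alpha>) = length w" and "fits_word w \<alpha>"
  shows "G_comp_le (run_composition w) \<alpha>"
  using assms
proof (induction w arbitrary: \<alpha>)
  case Nil
  then have "\<alpha> = []" by (cases \<alpha>) auto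
  then show ?case by (simp add: G_comp_le_def)
next
  case (Cons x w)
  then obtain a g \<alpha>' where \<alpha>: "\<alpha> = (Suc a, g) # \<alpha>'"
    by (cases \<alpha>) (auto simp: gr0_conv_Suc)
  show ?case
  proof (cases "a = 0")
    case True
    have IH: "G_comp_le (run_composition w) \<alpha>'"
      using Cons.prems True \<alpha> by (intro Cons.IH) auto
    have sx: "snd x = g" using Cons.prems \<alpha> by simp
    show ?thesis
    proof (cases "run_composition (x # w) = (1, g) # run_composition w")
      case True
      then show ?thesis using G_comp_le_Cons[OF IH, of "(1, g)"] \<alpha> \<open>a = 0\<close> by simp
    next
      case False
      then obtain b \<beta> where b: "run_composition w = (b, g) # \<beta>"
        and m: "run_composition (x # w) = (Suc b, g) # \<beta>"
        using sx by (auto split: list.splits if_splits)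
      have "b > 0" using run_composition_ConsD(3)[OF b] .
      then have "G_comp_cover ((Suc b, g) # \<beta>) ((1, g) # (b, g) # \<beta>)"
        using G_comp_cover.intros[of 1 b "[]" g \<beta>] by simp
      then have "G_comp_le (run_composition (x # w)) ((1, g) # run_composition w)"
        using m b by (simp add: G_comp_le_def)
      then show ?thesis using G_comp_le_Cons[OF IH, of "(1, g)"] \<alpha> \<open>a = 0\<close>
        by (auto simp: G_comp_le_def)
    qed
  next
    case False
    have IH: "G_comp_le (run_composition w) ((a, g) # \<alpha>')"
      using Cons.prems False \<alpha> by (intro Cons.IH) auto
    have "w \<noteq> []" using Cons.prems(2) False \<alpha> by auto
    then obtain y w' where w: "w = y # w'" by (cases w) auto
    obtain a' where a: "a = Suc a'" using False by (cases a) auto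
    have xy: "snd x = g" "snd y = g" "fst x < fst y"
      using Cons.prems unfolding \<alpha> w a by auto
    obtain b h \<beta> where b: "run_composition w = (b, h) # \<beta>"
      using \<open>w \<noteq> []\<close> by (cases "run_composition w") auto
    have "h = g" using run_composition_ConsD[OF b] xy w by simp
    then have "run_composition (x # w) = (Suc b, g) # \<beta>" using b xy w by simp
    then show ?thesis using G_comp_le_enlarge_head[of b g \<beta> "(a, g) # \<alpha>'"] IH b \<open>h = g\<close> \<alpha> by simp
  qed
qed

text \<open>
  Since splitting a part preserves fitting, the compositions that a word fits form the
  principal up-set generated by its greedy composition. This turns
  \<open>X\<^sub>\<alpha>\<close> into the sum of all \<open>u\<close> that fit \<open>\<alpha>\<close>.
\<close>

lemma run_composition_le_iff:
  assumes "\<forall>x \<in> set \<alpha>. fst x > 0" and "sum_list (map fst \<alpha>) = length w"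
  shows "G_comp_le (run_composition w) \<alpha> \<longleftrightarrow> fits_word w \<alpha>"
  using run_composition_le[OF assms] fits_word_mono[of "run_composition w" \<alpha> w]
    fits_run_composition[of w] by blast

text \<open>
  Length is a strict rank function for the refinement order. It makes the greedy composition
  the unique shortest one, and it drives the triangularity argument for injectivity.
\<close>

lemma G_comp_le_length:
  assumes "G_comp_le \<alpha> \<beta>" shows "length \<alpha> \<le> length \<beta> \<and> (length \<alpha> = length \<beta> \<longrightarrow> \<alpha> = \<beta>)"
  using assms unfolding G_comp_le_def
proof (induction rule: rtranclp_induct)
  case base
  then show ?case by simp
next
  case (step \<beta> \<gamma>)
  from step.hyps(2) have "length \<gamma> = Suc (length \<beta>)" by cases simp
  with step.IH show ?case by auto
qed

text \<open>
  A word whose greedy composition is the prescribed one: the parts are filled with intervals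
  of consecutive numbers, the largest numbers first, so that there is a descent at
  every boundary between parts. It witnesses that no \<open>Y\<^sub>\<alpha>\<close> vanishes.
\<close>

fun descending_blocks_word :: "(nat \<times> 'g) list \<Rightarrow> (nat \<times> 'g) list" where
  "descending_blocks_word [] = []"
| "descending_blocks_word ((a, g) # \<alpha>) =
     map (\<lambda>i. (i, g)) [Suc (sum_list (map fst \<alpha>))..<Suc (sum_list (map fst \<alpha>) + a)] @
     descending_blocks_word \<alpha>"

lemma descending_blocks_word_letters:
  "distinct (map fst (descending_blocks_word \<alpha>)) \<and>
   set (map fst (descending_blocks_word \<alpha>)) = {1..sum_list (map fst \<alpha>)} \<and>
   snd ` set (descending_blocks_word \<alpha>) \<subseteq> snd ` set \<alpha>"
proof (induction \<alpha> rule: descending_blocks_word.induct)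
  case 1
  then show ?case by simp
next
  case (2 a g \<alpha>)
  then show ?case by (auto simp: comp_def)
qed

lemma run_composition_increasing_append:
  assumes "a > 0" and "\<forall>x \<in> set w. fst x < m"
  shows "run_composition (map (\<lambda>i. (i, g)) [m..<m + a] @ w) = (a, g) # run_composition w"
  using assms
proof (induction a arbitrary: m)
  case 0
  then show ?case by simp
next
  case (Suc a)
  have upt: "[m..<m + Suc a] = m # [Suc m..<Suc m + a]"
    by (simp add: upt_rec)
  show ?case
  proof (cases "a = 0")
    case True
    show ?thesis
    proof (cases w)
      case Nil
      then show ?thesis using True by simp
    next
      case (Cons y w')
      then obtain b h \<beta> where "run_composition (y # w') = (b, h) # \<beta>"
        by (cases "run_composition (y # w')") (auto simp del: run_composition.simps)
      then show ?thesis using True Suc.prems Cons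
        by (simp add: run_composition_Cons del: run_composition.simps)
    qed
  next
    case False
    have "run_composition (map (\<lambda>i. (i, g)) [Suc m..<Suc m + a] @ w) = (a, g) # run_composition w"
      using False Suc.prems by (intro Suc.IH) auto
    moreover have "fst (hd (map (\<lambda>i. (i, g)) [Suc m..<Suc m + a] @ w)) = Suc m"
      using False by (simp add: hd_append hd_map)
    ultimately show ?thesis unfolding upt by simp
  qed
qed

lemma run_composition_descending_blocks_word:
  assumes "\<forall>x \<in> set \<alpha>. fst x > 0"
  shows "run_composition (descending_blocks_word \<alpha>) = \<alpha>"
  using assms
proof (induction \<alpha> rule: descending_blocks_word.induct)
  case 1
  then show ?case by simp
next
  case (2 a g \<alpha>)
  have "\<forall>x \<in> set (descending_blocks_word \<alpha>). fst x < Suc (sum_list (map fst \<alpha>))"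
  proof
    fix x assume "x \<in> set (descending_blocks_word \<alpha>)"
    then have "fst x \<in> set (map fst (descending_blocks_word \<alpha>))" by simp
    then have "fst x \<in> {1..sum_list (map fst \<alpha>)}"
      by (simp only: descending_blocks_word_letters)
    then show "fst x < Suc (sum_list (map fst \<alpha>))" by simp
  qed
  then have "run_composition (descending_blocks_word ((a, g) # \<alpha>)) =
      (a, g) # run_composition (descending_blocks_word \<alpha>)"
    using 2(2) unfolding descending_blocks_word.simps add_Suc[symmetric]
    by (intro run_composition_increasing_append) auto
  then show ?case using 2 by simp
qed

section \<open>Ordered partitions cut out of words\<close>

text \<open>
  The blocks are written one after the other, each in increasing order. For a partition of type
  \<open>\<alpha>\<close> this word fits \<open>\<alpha>\<close>, and cutting it into segments of the lengths in \<open>\<alpha>\<close>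
  gives the partition back.
\<close>

definition partition_word :: "(nat set \<times> 'g) list \<Rightarrow> (nat \<times> 'g) list" where
  "partition_word P = concat (map (\<lambda>(B, g). map (\<lambda>i. (i, g)) (sorted_list_of_set B)) P)"

fun cut_word :: "(nat \<times> 'g) list \<Rightarrow> (nat \<times> 'g) list \<Rightarrow> (nat set \<times> 'g) list" where
  "cut_word w [] = []"
| "cut_word w ((a, g) # \<alpha>) = (fst ` set (take a w), g) # cut_word (drop a w) \<alpha>"

lemma cut_partition_word:
  assumes "\<forall>(B, g) \<in> set P. finite B"
  shows "cut_word (partition_word P) (G_partition_type P) = P"
  using assms
proof (induction P)
  case Nil
  then show ?case by (simp add: G_partition_type_def)
next
  case (Cons p P)
  obtain B g where p: "p = (B, g)" by (cases p)
  let ?w = "map (\<lambda>i. (i, g)) (sorted_list_of_set B)"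
  have "length ?w = card B" by simp
  then have *: "take (card B) (?w @ v) = ?w" "drop (card B) (?w @ v) = v" for v
    by (metis append_eq_conv_conj)+
  show ?case
    using Cons * unfolding p
    by (auto simp: G_partition_type_def partition_word_def image_image)
qed

lemma fits_partition_word: "fits_word (partition_word P) (G_partition_type P)"
proof (induction P)
  case Nil
  then show ?case by (simp add: G_partition_type_def)
next
  case (Cons p P)
  obtain B g where p: "p = (B, g)" by (cases p)
  let ?w = "map (\<lambda>i. (i, g)) (sorted_list_of_set B)"
  have "length ?w = card B" by simp
  then have *: "take (card B) (?w @ v) = ?w" "drop (card B) (?w @ v) = v" for v
    by (metis append_eq_conv_conj)+
  show ?case
    using Cons * unfolding p
    by (auto simp: G_partition_type_def partition_word_def comp_def)
qed

lemma partition_word_cut: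
  assumes "fits_word w \<alpha>" and "sum_list (map fst \<alpha>) = length w"
  shows "partition_word (cut_word w \<alpha>) = w" and "G_partition_type (cut_word w \<alpha>) = \<alpha>"
proof -
  have "partition_word (cut_word w \<alpha>) = w \<and> G_partition_type (cut_word w \<alpha>) = \<alpha>"
    using assms
  proof (induction w \<alpha> rule: cut_word.induct)
    case (1 w)
    then show ?case by (simp add: partition_word_def G_partition_type_def)
  next
    case (2 w a g \<alpha>)
    let ?t = "take a w"
    have IH: "partition_word (cut_word (drop a w) \<alpha>) = drop a w"
      "G_partition_type (cut_word (drop a w) \<alpha>) = \<alpha>"
      using 2 by auto
    have len: "length ?t = a" using 2 by simp
    have srt: "sorted_wrt (<) (map fst ?t)" and col: "\<forall>x \<in> set ?t. snd x = g"
      using 2 by auto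
    have "sorted_list_of_set (set (map fst ?t)) = map fst ?t"
      using srt by (metis strict_sorted_iff sorted_list_of_set.idem_if_sorted_distinct)
    moreover have "map (\<lambda>i. (i, g)) (map fst ?t) = ?t"
      using col by (auto intro!: map_idI)
    ultimately have "map (\<lambda>i. (i, g)) (sorted_list_of_set (fst ` set ?t)) = ?t" by simp
    moreover have "card (fst ` set ?t) = a"
      using srt len by (metis distinct_card length_map list.set_map strict_sorted_iff)
    ultimately show ?case using IH
      by (simp add: partition_word_def G_partition_type_def)
  qed
  then show "partition_word (cut_word w \<alpha>) = w" and "G_partition_type (cut_word w \<alpha>) = \<alpha>" by auto
qed

text \<open>
  Two partitions of the same type are cut at the same places, so a permutation that carries
  the word of one to the word of the other carries the blocks along. This is how transitivity
  of the symmetric group on a type is obtained.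
\<close>

lemma cut_word_relabel:
  "cut_word (map (\<lambda>(i, g). (\<pi> i, g)) w) \<alpha> = G_partition_act \<pi> (cut_word w \<alpha>)"
  by (induction w \<alpha> rule: cut_word.induct)
     (simp_all add: G_partition_act_def take_map drop_map image_image case_prod_unfold)

text \<open>
  Overlapping or repeated blocks show as repeated letters once a word is sorted by blocks. Hence
  being an ordered partition can be read off from the action on a single word, which makes the
  closure properties of ordered \<open>G\<close>-partitions consequences of identities between actions.
\<close>

lemma distinct_concat_filter_iff:
  assumes "distinct xs" and "\<forall>B \<in> set Bs. B \<noteq> {} \<and> B \<subseteq> set xs"
  shows "distinct (concat (map (\<lambda>B. filter (\<lambda>i. i \<in> B) xs) Bs)) \<longleftrightarrow>
         distinct Bs \<and> disjoint (set Bs)"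
  using assms(2)
proof (induction Bs)
  case Nil
  then show ?case by simp
next
  case (Cons B Bs)
  have "set (concat (map (\<lambda>B. filter (\<lambda>i. i \<in> B) xs) Bs)) = \<Union>(set Bs)"
    using Cons.prems by auto
  moreover have "set (filter (\<lambda>i. i \<in> B) xs) = B" using Cons.prems by auto
  moreover have "distinct (B # Bs) \<and> disjoint (set (B # Bs)) \<longleftrightarrow>
      (distinct Bs \<and> disjoint (set Bs)) \<and> B \<inter> \<Union>(set Bs) = {}"
    using Cons.prems by (auto simp: pairwise_insert disjnt_def)
  ultimately show ?case using Cons assms(1) by auto
qed

(* Keeps the index list [1..<Suc n] of a word in one piece. *)
declare upt_Suc [simp del]

lemma strict_mono_on_upt:
  "strict_mono_on (set [s..<t]) p \<longleftrightarrow> sorted_wrt (\<lambda>i j. p i < (p j :: nat)) [s..<t]"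
proof
  assume "strict_mono_on (set [s..<t]) p"
  then show "sorted_wrt (\<lambda>i j. p i < p j) [s..<t]"
    by (auto simp: strict_mono_on_def intro!: sorted_wrt_mono_rel[OF _ sorted_wrt_upt])
next
  assume *: "sorted_wrt (\<lambda>i j. p i < p j) [s..<t]"
  show "strict_mono_on (set [s..<t]) p"
  proof (rule strict_mono_onI)
    fix i j assume "i \<in> set [s..<t]" "j \<in> set [s..<t]" "i < j"
    then show "p i < p j"
      using sorted_wrt_nth_less[OF *, of "i - s" "j - s"] by auto
  qed
qed

text \<open>
  The offset \<open>t\<close> makes the induction over the parts possible: after the first part the
  positions start at a later point of the word.
\<close>

lemma G_comp_fits_segment:
  "(\<forall>r < length \<alpha>.
      let s = t + sum_list (map fst (take r \<alpha>)); I = {s + 1..s + fst (\<alpha> ! r)}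
      in strict_mono_on I (p :: nat \<Rightarrow> nat) \<and> (\<forall>i\<in>I. c i = snd (\<alpha> ! r))) \<longleftrightarrow>
   fits_word (map (\<lambda>i. (p i, c i)) [Suc t..<Suc (t + sum_list (map fst \<alpha>))]) \<alpha>"
proof (induction \<alpha> arbitrary: t)
  case Nil
  then show ?case by simp
next
  case (Cons x \<alpha>)
  obtain a g where x: "x = (a, g)" by (cases x)
  let ?w = "map (\<lambda>i. (p i, c i)) [Suc t..<Suc (t + sum_list (map fst (x # \<alpha>)))]"
  have "[Suc t..<Suc (t + sum_list (map fst (x # \<alpha>)))] =
      [Suc t..<Suc (t + a)] @ [Suc (t + a)..<Suc (t + a + sum_list (map fst \<alpha>))]"
    using upt_add_eq_append[of "Suc t" "Suc (t + a)" "sum_list (map fst \<alpha>)"] x by (simp add: add.assoc)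
  then have w: "take a ?w = map (\<lambda>i. (p i, c i)) [Suc t..<Suc (t + a)]"
    "drop a ?w = map (\<lambda>i. (p i, c i)) [Suc (t + a)..<Suc (t + a + sum_list (map fst \<alpha>))]"
    by simp_all
  have I: "set [Suc t..<Suc (t + a)] = {t + 1..t + a}" by auto
  have "sorted_wrt (<) (map fst (take a ?w)) \<longleftrightarrow> strict_mono_on {t + 1..t + a} p"
    unfolding w I[symmetric] strict_mono_on_upt by (simp add: sorted_wrt_map comp_def)
  moreover have "(\<forall>y \<in> set (take a ?w). snd y = g) \<longleftrightarrow> (\<forall>i \<in> {t + 1..t + a}. c i = g)"
    unfolding w I[symmetric] by simp
  ultimately show ?case
    unfolding length_Cons All_less_Suc2 x fits_word.simps
    using Cons.IH[of "t + a"] w x by (simp add: add.assoc Let_def)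
qed

section \<open>The action of ordered \<open>G\<close>-partitions on words\<close>

locale coloured_words = group G for G (structure) + fixes n :: nat
begin

text \<open>
  The chambers: ordered \<open>G\<close>-partitions into singletons, written as words of pairs
  (letter, colour). They are the words of the elements of the wreath product.
\<close>

definition words :: "(nat \<times> 'a) list set" where
  "words = {w. distinct (map fst w) \<and> fst ` set w = {1..n} \<and> snd ` set w \<subseteq> carrier G}"

definition word :: "(nat \<Rightarrow> nat) \<times> (nat \<Rightarrow> 'a) \<Rightarrow> (nat \<times> 'a) list" where
  "word u = map (\<lambda>i. (fst u i, snd u i)) [1..<Suc n]"

text \<open>
  Outside \<open>{1..n}\<close> the values are those forced by \<^const>\<open>permutes\<close> and by extensionality.
\<close>

definition unword :: "(nat \<times> 'a) list \<Rightarrow> (nat \<Rightarrow> nat) \<times> (nat \<Rightarrow> 'a)" where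
  "unword w = (\<lambda>i. if i \<in> {1..n} then fst (w ! (i - 1)) else i, \<lambda>i\<in>{1..n}. snd (w ! (i - 1)))"

abbreviation wreath where "wreath \<equiv> wreath_product G n"

lemma length_words: "w \<in> words \<Longrightarrow> length w = n"
  using distinct_card[of "map fst w" for w :: "(nat \<times> 'a) list"] by (force simp: words_def)

lemma wreath_carrier_iff:
  "u \<in> carrier wreath \<longleftrightarrow> fst u permutes {1..n} \<and> snd u \<in> {1..n} \<rightarrow>\<^sub>E carrier G"
  by (cases u) (simp add: wreath_product_def)

lemma wreath_mult:
  "v \<otimes>\<^bsub>wreath\<^esub> u = (fst v \<circ> fst u, \<lambda>i\<in>{1..n}. snd v (fst u i) \<otimes> snd u i)"
  by (simp add: wreath_product_def split_def)

lemma wreath_one: "\<one>\<^bsub>wreath\<^esub> = (id, \<lambda>i\<in>{1..n}. \<one>)"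
  by (simp add: wreath_product_def)

lemma wreath_mult_closed:
  assumes "v \<in> carrier wreath" "u \<in> carrier wreath"
  shows "v \<otimes>\<^bsub>wreath\<^esub> u \<in> carrier wreath"
  using assms permutes_in_image[of "fst u" "{1..n}"]
  by (auto simp: wreath_carrier_iff wreath_mult permutes_compose PiE_iff)

lemma wreath_one_closed: "\<one>\<^bsub>wreath\<^esub> \<in> carrier wreath"
  by (simp add: wreath_carrier_iff wreath_one permutes_id)

lemma wreath_r_one: "v \<in> carrier wreath \<Longrightarrow> v \<otimes>\<^bsub>wreath\<^esub> \<one>\<^bsub>wreath\<^esub> = v"
  by (cases v) (auto simp: wreath_carrier_iff wreath_one wreath_mult PiE_iff extensional_def fun_eq_iff)

lemma word_in_words:
  assumes "u \<in> carrier wreath" shows "word u \<in> words"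
proof -
  have p: "fst u permutes {1..n}" and c: "snd u \<in> {1..n} \<rightarrow>\<^sub>E carrier G"
    using assms by (auto simp: wreath_carrier_iff)
  have "fst ` set (word u) = fst u ` {1..n}" by (auto simp: word_def image_image)
  also have "\<dots> = {1..n}" using permutes_image[OF p] .
  finally have "fst ` set (word u) = {1..n}" .
  moreover have "map fst (word u) = map (fst u) [1..<Suc n]" by (simp add: word_def comp_def)
  then have "distinct (map fst (word u))"
    using permutes_inj_on[OF p] by (simp add: distinct_map)
  moreover have "snd ` set (word u) \<subseteq> carrier G" using c by (auto simp: word_def PiE_iff)
  ultimately show ?thesis by (simp add: words_def)
qed

lemma unword_word:
  assumes "u \<in> carrier wreath" shows "unword (word u) = u"
proof -
  have "fst (unword (word u)) = fst u"
    using assms permutes_not_in[of "fst u" "{1..n}"]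
    by (auto simp: unword_def word_def wreath_carrier_iff fun_eq_iff)
  moreover have "snd (unword (word u)) = snd u"
    using assms by (auto simp: unword_def word_def wreath_carrier_iff fun_eq_iff PiE_iff extensional_def)
  ultimately show ?thesis by (simp add: prod_eq_iff)
qed

lemma word_unword:
  assumes "w \<in> words" shows "word (unword w) = w"
  using length_words[OF assms]
  by (intro nth_equalityI) (auto simp: word_def unword_def)

lemma unword_in_wreath:
  assumes "w \<in> words" shows "unword w \<in> carrier wreath"
proof -
  note len = length_words[OF assms]
  have "map fst (map (\<lambda>i. w ! (i - 1)) [1..<Suc n]) = map fst w"
    using len by (intro nth_equalityI) auto
  then have *: "map (\<lambda>i. fst (w ! (i - 1))) [1..<Suc n] = map fst w"
    by (simp add: comp_def)
  have S: "set [1..<Suc n] = {1..n}" by auto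
  have "inj_on (\<lambda>i. fst (w ! (i - 1))) {1..n}"
    using assms arg_cong[OF *, of distinct] S by (simp add: words_def distinct_map)
  moreover have "(\<lambda>i. fst (w ! (i - 1))) ` {1..n} = {1..n}"
    using assms arg_cong[OF *, of set] S by (simp add: words_def)
  ultimately have "bij_betw (\<lambda>i. fst (w ! (i - 1))) {1..n} {1..n}"
    unfolding bij_betw_def ..
  then have "bij_betw (fst (unword w)) {1..n} {1..n}"
    by (rule bij_betw_cong[THEN iffD1, rotated]) (simp add: unword_def)
  then have "fst (unword w) permutes {1..n}"
    by (rule bij_imp_permutes) (auto simp: unword_def)
  moreover have "snd (w ! (i - 1)) \<in> carrier G" if "i \<in> {1..n}" for i
    using that len assms by (auto simp: words_def)
  ultimately show ?thesis by (simp add: wreath_carrier_iff unword_def)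
qed

text \<open>
  Left multiplication by \<open>v\<close> in the wreath product, seen on words: it changes each letter
  and its colour in a way that depends on the letter only.
\<close>

definition relabel :: "(nat \<Rightarrow> nat) \<times> (nat \<Rightarrow> 'a) \<Rightarrow> (nat \<times> 'a) list \<Rightarrow> (nat \<times> 'a) list" where
  "relabel v w = map (\<lambda>(i, k). (fst v i, snd v i \<otimes> k)) w"

lemma word_mult: "word (v \<otimes>\<^bsub>wreath\<^esub> u) = relabel v (word u)"
  by (simp add: word_def relabel_def wreath_mult)

lemma relabel_in_words:
  assumes v: "v \<in> carrier wreath" and w: "w \<in> words"
  shows "relabel v w \<in> words"
  using word_in_words[OF wreath_mult_closed[OF v unword_in_wreath[OF w]]]
  by (simp add: word_mult word_unword[OF w])

text \<open>
  The product of \<^const>\<open>G_partition_mult\<close> with a chamber as the right factor: the letters are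
  sorted by the block that contains them, keeping their order within a block, and the colour
  of the block is multiplied from the right.
\<close>

definition partition_act :: "(nat set \<times> 'a) list \<Rightarrow> (nat \<times> 'a) list \<Rightarrow> (nat \<times> 'a) list" where
  "partition_act P w =
     concat (map (\<lambda>(B, g). map (\<lambda>(i, k). (i, k \<otimes> g)) (filter (\<lambda>x. fst x \<in> B) w)) P)"

lemma partition_act_simps [simp]:
  "partition_act [] w = []"
  "partition_act ((B, g) # P) w =
     map (\<lambda>(i, k). (i, k \<otimes> g)) (filter (\<lambda>x. fst x \<in> B) w) @ partition_act P w"
  "partition_act (P @ Q) w = partition_act P w @ partition_act Q w"
  by (simp_all add: partition_act_def)

text \<open>
  A colour \<open>k\<close> becomes \<open>k h\<close> under \<open>Q\<close> and then \<open>(k h) g\<close> under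
  \<open>P\<close>, which is why the product of partitions carries \<open>h g\<close>. The blocks of \<open>P\<close> are
  sorted out last and so determine the order first, as in the lexicographic order of the product.
\<close>

lemma partition_act_mult:
  assumes "snd ` set P \<subseteq> carrier G" "snd ` set Q \<subseteq> carrier G" "snd ` set w \<subseteq> carrier G"
  shows "partition_act (G_partition_mult G P Q) w = partition_act P (partition_act Q w)"
  using assms(1)
proof (induction P)
  case Nil
  then show ?case by (simp add: G_partition_mult_def)
next
  case (Cons p P)
  obtain B g where p: "p = (B, g)" by (cases p)
  have g: "g \<in> carrier G" using Cons.prems p by simp
  have inner: "map (\<lambda>(i, k). (i, k \<otimes> (h \<otimes> g))) (filter (\<lambda>x. fst x \<in> B \<inter> C) w) =
      map (\<lambda>(i, k). (i, k \<otimes> g))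
        (filter (\<lambda>x. fst x \<in> B) (map (\<lambda>(i, k). (i, k \<otimes> h)) (filter (\<lambda>x. fst x \<in> C) w)))"
    if "h \<in> carrier G" for C h
    using assms(3) that g by (induction w) (auto simp: m_assoc)
  \<comment> \<open>Empty intersections may be omitted from the product because no letter lies in them.\<close>
  have empty: "filter (\<lambda>x. fst x \<in> B \<and> fst x \<in> C) w = []" if "B \<inter> C = {}" for C
    using that by (auto simp: filter_empty_conv)
  have "partition_act (G_partition_mult G [(B, g)] Q) w =
      map (\<lambda>(i, k). (i, k \<otimes> g)) (filter (\<lambda>x. fst x \<in> B) (partition_act Q w))"
    using assms(2)
  proof (induction Q)
    case Nil
    then show ?case by (simp add: G_partition_mult_def)
  next
    case (Cons q Q)
    obtain C h where q: "q = (C, h)" by (cases q)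
    have "partition_act (G_partition_mult G [(B, g)] (q # Q)) w =
        map (\<lambda>(i, k). (i, k \<otimes> (h \<otimes> g))) (filter (\<lambda>x. fst x \<in> B \<inter> C) w) @
        partition_act (G_partition_mult G [(B, g)] Q) w"
      using empty[of C] q by (auto simp: G_partition_mult_def)
    also have "\<dots> = map (\<lambda>(i, k). (i, k \<otimes> g)) (filter (\<lambda>x. fst x \<in> B) (partition_act (q # Q) w))"
      using Cons q inner[of h C] by simp
    finally show ?case .
  qed
  moreover have "G_partition_mult G (p # P) Q =
      G_partition_mult G [(B, g)] Q @ G_partition_mult G P Q"
    by (simp add: G_partition_mult_def p)
  ultimately show ?case using Cons p by simp
qed

text \<open>
  Partitions act on colours from the right and on positions, while the wreath product acts
  from the left and on letters. The two actions commute up to the renaming of the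
  letters inside the blocks.
\<close>

lemma partition_act_relabel:
  assumes inj: "inj (fst v)" and v: "\<forall>i \<in> fst ` set w. snd v i \<in> carrier G"
    and P: "snd ` set P \<subseteq> carrier G" and w: "snd ` set w \<subseteq> carrier G"
  shows "partition_act (G_partition_act (fst v) P) (relabel v w) = relabel v (partition_act P w)"
  using P
proof (induction P)
  case Nil
  then show ?case by (simp add: G_partition_act_def relabel_def)
next
  case (Cons p P)
  obtain B g where p: "p = (B, g)" by (cases p)
  have g: "g \<in> carrier G" using Cons.prems p by simp
  have "map (\<lambda>(i, k). (i, k \<otimes> g)) (filter (\<lambda>x. fst x \<in> fst v ` B) (relabel v w)) =
      relabel v (map (\<lambda>(i, k). (i, k \<otimes> g)) (filter (\<lambda>x. fst x \<in> B) w))"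
    using v w g
    by (induction w) (auto simp: relabel_def m_assoc inj_eq[OF inj])
  with Cons p show ?case by (simp add: G_partition_act_def relabel_def)
qed

lemma map_fst_partition_act:
  "map fst (partition_act P w) =
   concat (map (\<lambda>B. filter (\<lambda>i. i \<in> B) (map fst w)) (map fst P))"
proof (induction P)
  case Nil
  then show ?case by simp
next
  case (Cons p P)
  then show ?case
    by (cases p) (simp add: filter_map comp_def case_prod_unfold)
qed

lemma snd_partition_act:
  assumes "snd ` set P \<subseteq> carrier G" "snd ` set w \<subseteq> carrier G"
  shows "snd ` set (partition_act P w) \<subseteq> carrier G"
  using assms(1)
proof (induction P)
  case Nil
  then show ?case by simp
next
  case (Cons p P)
  then show ?case using assms(2)
    by (cases p) (auto simp: image_subset_iff)
qed

text \<open>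
  Testing on one chamber suffices, and any chamber will do. The two closure lemmas
  below use the freedom of choice: the product is tested on the identity chamber, a
  renamed partition on the renamed identity chamber.
\<close>

lemma ordered_G_partitions_iff:
  assumes w: "w \<in> words"
  shows "P \<in> ordered_G_partitions G n \<longleftrightarrow>
    (\<forall>(B, g) \<in> set P. B \<noteq> {} \<and> B \<subseteq> {1..n} \<and> g \<in> carrier G) \<and> partition_act P w \<in> words"
    (is "?L \<longleftrightarrow> ?R")
proof -
  let ?Bs = "map fst P"
  have ws: "distinct (map fst w)" "set (map fst w) = {1..n}" "snd ` set w \<subseteq> carrier G"
    using w by (auto simp: words_def)
  have L: "?L \<longleftrightarrow> (\<forall>(B, g) \<in> set P. B \<noteq> {} \<and> B \<subseteq> {1..n} \<and> g \<in> carrier G) \<and>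
      (distinct ?Bs \<and> disjoint (set ?Bs)) \<and> \<Union>(set ?Bs) = {1..n}"
  proof -
    have "(\<forall>(B, g) \<in> set P. B \<noteq> {} \<and> B \<subseteq> {1..n} \<and> g \<in> carrier G) \<longleftrightarrow>
        {} \<notin> set ?Bs \<and> \<Union>(set ?Bs) \<subseteq> {1..n} \<and> set (map snd P) \<subseteq> carrier G"
      by (fastforce simp: image_iff)
    then show ?thesis unfolding ordered_G_partitions_def partition_on_def by blast
  qed
  show ?thesis
  proof (cases "\<forall>(B, g) \<in> set P. B \<noteq> {} \<and> B \<subseteq> {1..n} \<and> g \<in> carrier G")
    case True
    then have Bs: "\<forall>B \<in> set ?Bs. B \<noteq> {} \<and> B \<subseteq> set (map fst w)"
      and cP: "snd ` set P \<subseteq> carrier G" unfolding ws(2) by (auto dest!: bspec)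
    have "fst ` set (partition_act P w) = set (map fst (partition_act P w))" by simp
    also have "\<dots> = \<Union>(set ?Bs)"
    proof -
      have "set (concat (map (\<lambda>B. filter (\<lambda>i. i \<in> B) xs) Cs)) = \<Union>(set Cs)"
        if "\<forall>B \<in> set Cs. B \<noteq> {} \<and> B \<subseteq> set xs" for Cs and xs :: "nat list"
        using that by auto
      then show ?thesis unfolding map_fst_partition_act using Bs .
    qed
    finally have U: "fst ` set (partition_act P w) = \<Union>(set ?Bs)" .
    have D: "distinct (map fst (partition_act P w)) \<longleftrightarrow> distinct ?Bs \<and> disjoint (set ?Bs)"
      unfolding map_fst_partition_act using distinct_concat_filter_iff[OF ws(1) Bs] .
    show ?thesis unfolding L using True D U snd_partition_act[OF cP ws(3)]
      by (simp add: words_def)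
  next
    case False
    then show ?thesis unfolding L by blast
  qed
qed

lemma ordered_G_partitionsD:
  assumes "P \<in> ordered_G_partitions G n"
  shows "snd ` set P \<subseteq> carrier G" "\<forall>(B, g) \<in> set P. B \<noteq> {} \<and> B \<subseteq> {1..n} \<and> finite B \<and> g \<in> carrier G"
    "w \<in> words \<Longrightarrow> partition_act P w \<in> words"
proof -
  show *: "\<forall>(B, g) \<in> set P. B \<noteq> {} \<and> B \<subseteq> {1..n} \<and> finite B \<and> g \<in> carrier G"
    using assms finite_subset[of _ "{1..n}"]
      ordered_G_partitions_iff[OF word_in_words[OF wreath_one_closed], of P] by fastforce
  then show "snd ` set P \<subseteq> carrier G" by auto
  show "w \<in> words \<Longrightarrow> partition_act P w \<in> words"
    using assms ordered_G_partitions_iff by blast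
qed

lemma G_partition_mult_closed:
  assumes P: "P \<in> ordered_G_partitions G n" and Q: "Q \<in> ordered_G_partitions G n"
  shows "G_partition_mult G P Q \<in> ordered_G_partitions G n"
proof -
  let ?w = "word \<one>\<^bsub>wreath\<^esub>"
  have w: "?w \<in> words" using word_in_words[OF wreath_one_closed] .
  then have "snd ` set ?w \<subseteq> carrier G" by (simp add: words_def)
  then have "partition_act (G_partition_mult G P Q) ?w \<in> words"
    using ordered_G_partitionsD[OF P] ordered_G_partitionsD[OF Q] w by (simp add: partition_act_mult)
  moreover have "\<forall>(B, g) \<in> set (G_partition_mult G P Q). B \<noteq> {} \<and> B \<subseteq> {1..n} \<and> g \<in> carrier G"
    using ordered_G_partitionsD(2)[OF P] ordered_G_partitionsD(2)[OF Q]
    unfolding G_partition_mult_def by (fastforce split: if_splits)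
  ultimately show ?thesis using ordered_G_partitions_iff[OF w] by blast
qed

lemma G_partition_act_closed:
  assumes P: "P \<in> ordered_G_partitions G n" and \<pi>: "\<pi> permutes {1..n}"
  shows "G_partition_act \<pi> P \<in> ordered_G_partitions G n"
proof -
  let ?w = "word \<one>\<^bsub>wreath\<^esub>" and ?v = "(\<pi>, \<lambda>i\<in>{1..n}. \<one>)"
  have w: "?w \<in> words" using word_in_words[OF wreath_one_closed] .
  then have cw: "snd ` set ?w \<subseteq> carrier G" "fst ` set ?w = {1..n}" by (auto simp: words_def)
  have v: "?v \<in> carrier wreath" using \<pi> by (simp add: wreath_carrier_iff)
  have "partition_act (G_partition_act \<pi> P) (relabel ?v ?w) = relabel ?v (partition_act P ?w)"
    using partition_act_relabel[of ?v ?w P] permutes_inj[OF \<pi>] cw ordered_G_partitionsD[OF P]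
    by simp
  then have "partition_act (G_partition_act \<pi> P) (relabel ?v ?w) \<in> words"
    using relabel_in_words[OF v ordered_G_partitionsD(3)[OF P w]] by simp
  moreover have "\<forall>(B, g) \<in> set (G_partition_act \<pi> P). B \<noteq> {} \<and> B \<subseteq> {1..n} \<and> g \<in> carrier G"
    using ordered_G_partitionsD(2)[OF P] permutes_in_image[OF \<pi>]
    unfolding G_partition_act_def by fastforce
  ultimately show ?thesis using ordered_G_partitions_iff[OF relabel_in_words[OF v w]] by blast
qed

text \<open>
  The letters of the identity chamber stand in increasing order and carry the neutral colour,
  so sorting them by blocks writes out the partition.
\<close>

lemma partition_act_word_one:
  assumes "\<forall>(B, g) \<in> set P. B \<subseteq> {1..n} \<and> g \<in> carrier G"
  shows "partition_act P (word \<one>\<^bsub>wreath\<^esub>) = partition_word P"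
  using assms
proof (induction P)
  case Nil
  then show ?case by (simp add: partition_word_def)
next
  case (Cons p P)
  obtain B g where p: "p = (B, g)" by (cases p)
  have B: "B \<subseteq> {1..n}" "g \<in> carrier G" using Cons.prems p by auto
  have "filter (\<lambda>i. i \<in> B) [1..<Suc n] = sorted_list_of_set (set (filter (\<lambda>i. i \<in> B) [1..<Suc n]))"
    by (rule sorted_list_of_set.idem_if_sorted_distinct[symmetric])
       (simp_all add: sorted_wrt_filter)
  also have "set (filter (\<lambda>i. i \<in> B) [1..<Suc n]) = B" using B by auto
  finally have B': "filter (\<lambda>i. i \<in> B) [1..<Suc n] = sorted_list_of_set B" .
  have "word \<one>\<^bsub>wreath\<^esub> = map (\<lambda>i. (i, \<one>)) [1..<Suc n]"
    by (auto simp: word_def wreath_one)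
  then have "map (\<lambda>(i, k). (i, k \<otimes> g)) (filter (\<lambda>x. fst x \<in> B) (word \<one>\<^bsub>wreath\<^esub>)) =
      map (\<lambda>i. (i, g)) (sorted_list_of_set B)"
    using B B' by (simp add: filter_map comp_def)
  with Cons p show ?case by (simp add: partition_word_def)
qed

lemma G_partition_one_closed:
  assumes "n \<ge> 1" shows "[({1..n}, \<one>)] \<in> ordered_G_partitions G n"
  using assms by (auto simp: ordered_G_partitions_def intro: partition_on_space)

lemma partition_act_one:
  assumes "w \<in> words" shows "partition_act [({1..n}, \<one>)] w = w"
proof -
  have "filter (\<lambda>x. fst x \<in> {1..n}) w = w"
    using assms unfolding words_def filter_id_conv by blast
  then show ?thesis using assms by (auto simp: words_def intro!: map_idI)
qed

section \<open>The action on the wreath product\<close>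

text \<open>
  The action on chambers, transported to the elements of the wreath product.
\<close>

definition chamber_act ::
  "(nat set \<times> 'a) list \<Rightarrow> (nat \<Rightarrow> nat) \<times> (nat \<Rightarrow> 'a) \<Rightarrow> (nat \<Rightarrow> nat) \<times> (nat \<Rightarrow> 'a)" where
  "chamber_act P u = unword (partition_act P (word u))"

lemma word_chamber_act:
  assumes "P \<in> ordered_G_partitions G n" "u \<in> carrier wreath"
  shows "word (chamber_act P u) = partition_act P (word u)"
  using assms by (simp add: chamber_act_def word_unword ordered_G_partitionsD word_in_words)

lemma chamber_act_closed:
  assumes "P \<in> ordered_G_partitions G n" "u \<in> carrier wreath"
  shows "chamber_act P u \<in> carrier wreath"
  using assms by (simp add: chamber_act_def unword_in_wreath ordered_G_partitionsD word_in_words)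

lemma chamber_act_mult:
  assumes P: "P \<in> ordered_G_partitions G n" and Q: "Q \<in> ordered_G_partitions G n"
    and u: "u \<in> carrier wreath"
  shows "chamber_act (G_partition_mult G P Q) u = chamber_act P (chamber_act Q u)"
proof -
  have "snd ` set (word u) \<subseteq> carrier G" using word_in_words[OF u] by (simp add: words_def)
  then show ?thesis
    using partition_act_mult[of P Q "word u"] ordered_G_partitionsD(1)[OF P]
      ordered_G_partitionsD(1)[OF Q] word_chamber_act[OF Q u]
    by (simp add: chamber_act_def)
qed

lemma chamber_act_equivariant:
  assumes P: "P \<in> ordered_G_partitions G n" and v: "v \<in> carrier wreath" and u: "u \<in> carrier wreath"
  shows "chamber_act (G_partition_act (fst v) P) (v \<otimes>\<^bsub>wreath\<^esub> u) =
    v \<otimes>\<^bsub>wreath\<^esub> chamber_act P u"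
proof -
  have w: "fst ` set (word u) = {1..n}" "snd ` set (word u) \<subseteq> carrier G"
    using word_in_words[OF u] by (simp_all add: words_def)
  have \<pi>: "fst v permutes {1..n}" and c: "snd v \<in> {1..n} \<rightarrow>\<^sub>E carrier G"
    using v by (simp_all add: wreath_carrier_iff)
  have "partition_act (G_partition_act (fst v) P) (relabel v (word u)) =
      relabel v (partition_act P (word u))"
    using permutes_inj[OF \<pi>] c w ordered_G_partitionsD(1)[OF P]
    by (intro partition_act_relabel) (auto simp: PiE_iff)
  also have "\<dots> = word (v \<otimes>\<^bsub>wreath\<^esub> chamber_act P u)"
    by (simp add: word_mult word_chamber_act[OF P u])
  finally show ?thesis
    using unword_word[OF wreath_mult_closed[OF v chamber_act_closed[OF P u]]]
    by (simp add: chamber_act_def[of "G_partition_act (fst v) P"] word_mult)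
qed

lemma chamber_act_one: "u \<in> carrier wreath \<Longrightarrow> chamber_act [({1..n}, \<one>)] u = u"
  using partition_act_one[OF word_in_words] unword_word by (simp add: chamber_act_def)

lemma G_comp_fits_iff:
  assumes "\<alpha> \<in> G_compositions G n"
  shows "G_comp_fits u \<alpha> \<longleftrightarrow> fits_word (word u) \<alpha>"
  using G_comp_fits_segment[of \<alpha> 0 "fst u" "snd u"] assms
  by (simp add: G_comp_fits_def word_def G_compositions_def)

lemma run_composition_in_G_compositions:
  assumes "w \<in> words" shows "run_composition w \<in> G_compositions G n"
proof -
  have "snd ` set w \<subseteq> carrier G" using assms by (simp add: words_def)
  then have "\<forall>(a, g) \<in> set (run_composition w). a > 0 \<and> g \<in> carrier G"
    using run_composition_entries[of _ _ w] by blast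
  then show ?thesis
    using sum_run_composition[of w] length_words[OF assms] by (simp add: G_compositions_def)
qed

lemma G_comp_le_run_composition_iff:
  assumes "\<alpha> \<in> G_compositions G n" "w \<in> words"
  shows "G_comp_le (run_composition w) \<alpha> \<longleftrightarrow> fits_word w \<alpha>"
  using assms length_words[of w] by (intro run_composition_le_iff) (auto simp: G_compositions_def)

text \<open>
  By the up-set description, the greedy composition is below, hence shorter than, every other
  composition that the word fits; so the minimum in the definition of
  \<^const>\<open>Co\<close> is attained exactly once.
\<close>

lemma Co_eq_run_composition:
  assumes u: "u \<in> carrier wreath"
  shows "Co G n u = run_composition (word u)"
proof -
  let ?r = "run_composition (word u)"
  note w = word_in_words[OF u]
  have fits: "(\<alpha> \<in> G_compositions G n \<and> G_comp_fits u \<alpha>) \<longleftrightarrow>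
      \<alpha> \<in> G_compositions G n \<and> G_comp_le ?r \<alpha>" for \<alpha>
    using G_comp_fits_iff G_comp_le_run_composition_iff[OF _ w] by blast
  have r: "?r \<in> G_compositions G n \<and> G_comp_le ?r ?r"
    using run_composition_in_G_compositions[OF w] by (simp add: G_comp_le_def)
  show ?thesis
    unfolding Co_def fits
  proof (rule the_equality)
    show "is_arg_min length (\<lambda>\<alpha>. \<alpha> \<in> G_compositions G n \<and> G_comp_le ?r \<alpha>) ?r"
      using r G_comp_le_length[of ?r] by (force simp: is_arg_min_linorder)
  next
    fix \<alpha> assume "is_arg_min length (\<lambda>\<alpha>. \<alpha> \<in> G_compositions G n \<and> G_comp_le ?r \<alpha>) \<alpha>"
    then have "G_comp_le ?r \<alpha>" "length \<alpha> \<le> length ?r"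
      using r by (auto simp: is_arg_min_linorder)
    then show "\<alpha> = ?r" using G_comp_le_length[of ?r \<alpha>] by auto
  qed
qed

lemma cut_word_in_ordered_G_partitions:
  assumes \<alpha>: "\<alpha> \<in> G_compositions G n" and w: "w \<in> words" and fits: "fits_word w \<alpha>"
  shows "cut_word w \<alpha> \<in> ordered_G_partitions G n"
proof -
  let ?P = "cut_word w \<alpha>"
  have "sum_list (map fst \<alpha>) = length w"
    using \<alpha> length_words[OF w] by (simp add: G_compositions_def)
  note cut = partition_word_cut[OF fits this]
  have "fst B \<subseteq> fst ` set w" if "B \<in> set ?P" for B
    using that
  proof (induction w \<alpha> rule: cut_word.induct)
    case (2 w a g \<alpha>)
    then consider "B = (fst ` set (take a w), g)" | "B \<in> set (cut_word (drop a w) \<alpha>)" by auto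
    then show ?case
    proof cases
      case 1
      then show ?thesis using set_take_subset[of a w] by auto
    next
      case 2
      then show ?thesis using "2.IH" set_drop_subset[of a w] by blast
    qed
  qed simp
  moreover have "fst ` set w = {1..n}" using w by (simp add: words_def)
  ultimately have sub: "\<forall>(B, g) \<in> set ?P. B \<subseteq> {1..n}" by fastforce
  have "card B > 0 \<and> g \<in> carrier G" if "(B, g) \<in> set ?P" for B g
  proof -
    have "(card B, g) \<in> set (G_partition_type ?P)"
      using that by (force simp: G_partition_type_def)
    then show ?thesis using \<alpha> unfolding cut(2) by (auto simp: G_compositions_def)
  qed
  then have blocks: "\<forall>(B, g) \<in> set ?P. B \<noteq> {} \<and> B \<subseteq> {1..n} \<and> g \<in> carrier G"
    using sub by fastforce
  have "\<forall>(B, g) \<in> set ?P. B \<subseteq> {1..n} \<and> g \<in> carrier G" using blocks by auto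
  from partition_act_word_one[OF this]
  have "partition_act ?P (word \<one>\<^bsub>wreath\<^esub>) \<in> words" using w cut(1) by simp
  then show ?thesis
    using ordered_G_partitions_iff[OF word_in_words[OF wreath_one_closed]] blocks by blast
qed

lemma word_chamber_act_one:
  assumes P: "P \<in> ordered_G_partitions G n"
  shows "word (chamber_act P \<one>\<^bsub>wreath\<^esub>) = partition_word P"
proof -
  have "\<forall>(B, g) \<in> set P. B \<subseteq> {1..n} \<and> g \<in> carrier G"
    using ordered_G_partitionsD(2)[OF P] by auto
  then show ?thesis
    using word_chamber_act[OF P wreath_one_closed] partition_act_word_one by simp
qed

lemma partition_word_in_words:
  assumes "P \<in> ordered_G_partitions G n" shows "partition_word P \<in> words"
  using word_in_words[OF chamber_act_closed[OF assms wreath_one_closed]]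
  by (simp add: word_chamber_act_one[OF assms])

lemma cut_partition_word_type:
  assumes "P \<in> ordered_G_partitions G n"
  shows "cut_word (partition_word P) (G_partition_type P) = P"
  using ordered_G_partitionsD(2)[OF assms] by (intro cut_partition_word) auto

lemma G_partition_type_in_G_compositions:
  assumes "P \<in> ordered_G_partitions G n"
  shows "G_partition_type P \<in> G_compositions G n"
proof -
  have "sum_list (map fst (G_partition_type P)) = length (partition_word P)"
    by (simp add: G_partition_type_def partition_word_def length_concat comp_def case_prod_unfold)
  moreover have "\<forall>(a, g) \<in> set (G_partition_type P). a > 0 \<and> g \<in> carrier G"
    using ordered_G_partitionsD(2)[OF assms] by (auto simp: G_partition_type_def card_gt_0_iff)
  ultimately show ?thesis
    using length_words[OF partition_word_in_words[OF assms]] by (simp add: G_compositions_def)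
qed

text \<open>
  Evaluation at the identity chamber identifies the partitions of type \<open>\<alpha>\<close> with the
  summands of \<open>X\<^sub>\<alpha>\<close>; the inverse cuts a word into the segments prescribed by
  \<open>\<alpha>\<close>. This is the reason why \<open>\<sigma>\<^sub>\<alpha>\<close> is mapped to \<open>X\<^sub>\<alpha>\<close>.
\<close>

lemma bij_betw_chamber_act_one:
  assumes \<alpha>: "\<alpha> \<in> G_compositions G n"
  shows "bij_betw (\<lambda>P. chamber_act P \<one>\<^bsub>wreath\<^esub>)
    {P \<in> ordered_G_partitions G n. G_partition_type P = \<alpha>}
    {u \<in> carrier wreath. fits_word (word u) \<alpha>}"
proof (rule bij_betw_byWitness[where f' = "\<lambda>u. cut_word (word u) \<alpha>"])
  show "\<forall>P \<in> {P \<in> ordered_G_partitions G n. G_partition_type P = \<alpha>}.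
      cut_word (word (chamber_act P \<one>\<^bsub>wreath\<^esub>)) \<alpha> = P"
    using word_chamber_act_one cut_partition_word_type by auto
  have cut: "cut_word (word u) \<alpha> \<in> ordered_G_partitions G n"
    "partition_word (cut_word (word u) \<alpha>) = word u"
    "G_partition_type (cut_word (word u) \<alpha>) = \<alpha>"
    if "u \<in> carrier wreath" "fits_word (word u) \<alpha>" for u
    using cut_word_in_ordered_G_partitions[OF \<alpha> word_in_words[OF that(1)] that(2)]
      partition_word_cut[OF that(2)] \<alpha> length_words[OF word_in_words[OF that(1)]]
    by (simp_all add: G_compositions_def)
  show "\<forall>u \<in> {u \<in> carrier wreath. fits_word (word u) \<alpha>}.
      chamber_act (cut_word (word u) \<alpha>) \<one>\<^bsub>wreath\<^esub> = u"
  proof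
    fix u assume "u \<in> {u \<in> carrier wreath. fits_word (word u) \<alpha>}"
    then have u: "u \<in> carrier wreath" "fits_word (word u) \<alpha>" by auto
    have "word (chamber_act (cut_word (word u) \<alpha>) \<one>\<^bsub>wreath\<^esub>) = word u"
      using word_chamber_act_one[OF cut(1)[OF u]] cut(2)[OF u] by simp
    then show "chamber_act (cut_word (word u) \<alpha>) \<one>\<^bsub>wreath\<^esub> = u"
      using unword_word[OF u(1)] unword_word[OF chamber_act_closed[OF cut(1)[OF u] wreath_one_closed]]
      by metis
  qed
  show "(\<lambda>P. chamber_act P \<one>\<^bsub>wreath\<^esub>) ` {P \<in> ordered_G_partitions G n. G_partition_type P = \<alpha>}
      \<subseteq> {u \<in> carrier wreath. fits_word (word u) \<alpha>}"
    using chamber_act_closed[OF _ wreath_one_closed] word_chamber_act_one fits_partition_word by auto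
  show "(\<lambda>u. cut_word (word u) \<alpha>) ` {u \<in> carrier wreath. fits_word (word u) \<alpha>}
      \<subseteq> {P \<in> ordered_G_partitions G n. G_partition_type P = \<alpha>}"
    using cut by auto
qed

section \<open>The symmetric group acts transitively on each type\<close>

lemma map_snd_partition_word:
  "map snd (partition_word P) = concat (map (\<lambda>(a, g). replicate a g) (G_partition_type P))"
  by (induction P)
     (auto simp: partition_word_def G_partition_type_def comp_def map_replicate_const)

text \<open>
  The permutation sends the \<open>i\<close>-th letter of the word of \<open>P\<close> to the \<open>i\<close>-th
  letter of the word of \<open>Q\<close>. Since the types agree, so do the colours at each position.
\<close>

lemma G_partition_act_transitive:
  assumes P: "P \<in> ordered_G_partitions G n" and Q: "Q \<in> ordered_G_partitions G n"
    and type: "G_partition_type P = G_partition_type Q"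
  obtains \<pi> where "\<pi> permutes {1..n}" "G_partition_act \<pi> P = Q"
proof -
  let ?p = "chamber_act P \<one>\<^bsub>wreath\<^esub>" and ?q = "chamber_act Q \<one>\<^bsub>wreath\<^esub>"
  define \<pi> where "\<pi> = fst ?q \<circ> inv_into UNIV (fst ?p)"
  have p: "fst ?p permutes {1..n}" and q: "fst ?q permutes {1..n}"
    using chamber_act_closed[OF P wreath_one_closed] chamber_act_closed[OF Q wreath_one_closed]
    by (simp_all add: wreath_carrier_iff)
  have "map snd (word ?p) = map snd (word ?q)"
    using map_snd_partition_word[of P] map_snd_partition_word[of Q] type
    by (simp add: word_chamber_act_one[OF P] word_chamber_act_one[OF Q])
  then have "snd ?p i = snd ?q i" if "i \<in> set [1..<Suc n]" for i
    using that by (simp add: word_def comp_def)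
  then have "word ?q = map (\<lambda>(i, g). (\<pi> i, g)) (word ?p)"
    using permutes_inverses(2)[OF p] by (simp add: word_def \<pi>_def)
  then have "partition_word Q = map (\<lambda>(i, g). (\<pi> i, g)) (partition_word P)"
    by (simp add: word_chamber_act_one[OF P] word_chamber_act_one[OF Q])
  then have "G_partition_act \<pi> P = Q"
    using cut_partition_word_type[OF P] cut_partition_word_type[OF Q] type
      cut_word_relabel[of \<pi> "partition_word P" "G_partition_type P"] by simp
  moreover have "\<pi> permutes {1..n}"
    unfolding \<pi>_def by (rule permutes_compose[OF permutes_inv[OF p] q])
  ultimately show ?thesis using that by blast
qed

end

section \<open>Linear extension and renaming\<close>

lemma frag_extend_frag_extend:
  "frag_extend f (frag_extend g x) = frag_extend (\<lambda>a. frag_extend f (g a)) x"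
  using subset_UNIV[of "Poly_Mapping.keys x"]
  by (induction x rule: frag_induction) (simp_all add: frag_extend_diff)

lemma frag_extend_swap:
  "frag_extend (\<lambda>a. frag_extend (\<lambda>b. t a b) y) x = frag_extend (\<lambda>b. frag_extend (\<lambda>a. t a b) x) y"
  by (simp add: frag_extend_def frag_cmul_sum mult.commute)
     (rule sum.swap)

lemma int_algebra_simps:
  "carrier (int_algebra M) = {x. Poly_Mapping.keys x \<subseteq> carrier M}"
  "x \<otimes>\<^bsub>int_algebra M\<^esub> y = frag_extend (\<lambda>a. frag_extend (\<lambda>b. frag_of (a \<otimes>\<^bsub>M\<^esub> b)) y) x"
  "\<one>\<^bsub>int_algebra M\<^esub> = frag_of \<one>\<^bsub>M\<^esub>"
  "x \<oplus>\<^bsub>int_algebra M\<^esub> y = x + y"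
  by (simp_all add: int_algebra_def)

lemma frag_extend_of_keys_subset:
  assumes "\<And>a. a \<in> Poly_Mapping.keys x \<Longrightarrow> h a \<in> S"
  shows "Poly_Mapping.keys (frag_extend (\<lambda>a. frag_of (h a)) x) \<subseteq> S"
  using keys_frag_extend[of "\<lambda>a. frag_of (h a)" x] assms by (auto simp: keys_frag_of)

lemma keys_int_algebra_mult:
  assumes "\<And>a b. a \<in> Poly_Mapping.keys x \<Longrightarrow> b \<in> Poly_Mapping.keys y \<Longrightarrow> a \<otimes>\<^bsub>M\<^esub> b \<in> S"
  shows "Poly_Mapping.keys (x \<otimes>\<^bsub>int_algebra M\<^esub> y) \<subseteq> S"
proof -
  have "Poly_Mapping.keys (frag_extend (\<lambda>b. frag_of (a \<otimes>\<^bsub>M\<^esub> b)) y) \<subseteq> S"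
    if "a \<in> Poly_Mapping.keys x" for a
    using assms that by (intro frag_extend_of_keys_subset)
  then show ?thesis
    unfolding int_algebra_simps by (intro order_trans[OF keys_frag_extend]) auto
qed

lemma lookup_frag_extend_inj:
  assumes "inj h"
  shows "Poly_Mapping.lookup (frag_extend (\<lambda>a. frag_of (h a)) x) (h a) = Poly_Mapping.lookup x a"
  using subset_UNIV[of "Poly_Mapping.keys x"]
  by (induction x rule: frag_induction)
     (simp_all add: frag_extend_diff lookup_minus inj_eq[OF assms])

lemma lookup_sum_frag_of:
  assumes "finite S"
  shows "Poly_Mapping.lookup (\<Sum>a\<in>S. frag_of a) b = (if b \<in> S then 1 else 0)"
  using assms by (simp add: lookup_sum)

lemma G_partition_act_mult:
  assumes "inj \<pi>"
  shows "G_partition_act \<pi> (G_partition_mult G P Q) =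
    G_partition_mult G (G_partition_act \<pi> P) (G_partition_act \<pi> Q)"
proof -
  have *: "\<pi> ` B \<inter> \<pi> ` C = \<pi> ` (B \<inter> C)" for B C using image_Int[OF assms] by blast
  show ?thesis
    by (simp add: G_partition_act_def G_partition_mult_def map_concat comp_def case_prod_unfold *
        if_distrib[of "map _"] cong: if_cong)
qed

lemma G_partition_act_comp: "G_partition_act \<pi> (G_partition_act \<rho> P) = G_partition_act (\<pi> \<circ> \<rho>) P"
  by (simp add: G_partition_act_def image_image case_prod_unfold)

lemma G_partition_act_id: "G_partition_act id P = P"
  by (simp add: G_partition_act_def case_prod_unfold)

lemma G_partition_act_inverses:
  assumes "\<pi> permutes A"
  shows "G_partition_act (inv_into UNIV \<pi>) (G_partition_act \<pi> P) = P"
    "G_partition_act \<pi> (G_partition_act (inv_into UNIV \<pi>) P) = P"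
  using permutes_inv_o[OF assms] by (simp_all add: G_partition_act_comp G_partition_act_id)

lemma inj_G_partition_act:
  assumes "\<pi> permutes A" shows "inj (G_partition_act \<pi>)"
  using G_partition_act_inverses(1)[OF assms] by (metis injI)

lemma G_partition_type_act:
  assumes "inj \<pi>" shows "G_partition_type (G_partition_act \<pi> P) = G_partition_type P"
  by (auto simp: G_partition_type_def G_partition_act_def case_prod_unfold
      intro!: card_image inj_on_subset[OF assms])

section \<open>The invariant subalgebra\<close>

locale finite_coloured_words = coloured_words +
  assumes finite_carrier: "finite (carrier G)" and n_pos: "n \<ge> 1"
begin

abbreviation inv_alg where "inv_alg \<equiv> invariant_algebra G n"
abbreviation wreath_alg where "wreath_alg \<equiv> int_algebra wreath"

lemma finite_G_compositions: "finite (G_compositions G n)"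
proof (rule finite_subset)
  show "finite {\<alpha>. set \<alpha> \<subseteq> {1..n} \<times> carrier G \<and> length \<alpha> \<le> n}"
    using finite_carrier by (intro finite_lists_length_le) simp
  show "G_compositions G n \<subseteq> {\<alpha>. set \<alpha> \<subseteq> {1..n} \<times> carrier G \<and> length \<alpha> \<le> n}"
  proof
    fix \<alpha> assume \<alpha>: "\<alpha> \<in> G_compositions G n"
    have "set \<alpha> \<subseteq> {1..sum_list (map fst \<alpha>)} \<times> carrier G \<and> length \<alpha> \<le> sum_list (map fst \<alpha>)"
      if "\<forall>(a, g) \<in> set \<alpha>. a > 0 \<and> g \<in> carrier G"
      using that
    proof (induction \<alpha>)
      case (Cons x \<alpha>)
      obtain a g where x: "x = (a, g)" by (cases x)
      have "{1..sum_list (map fst \<alpha>)} \<subseteq> {1..sum_list (map fst (x # \<alpha>))}" by auto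
      then show ?case using Cons x by auto
    qed simp
    then show "\<alpha> \<in> {\<alpha>. set \<alpha> \<subseteq> {1..n} \<times> carrier G \<and> length \<alpha> \<le> n}"
      using \<alpha> by (auto simp: G_compositions_def)
  qed
qed

lemma finite_wreath: "finite (carrier wreath)"
  using finite_carrier by (simp add: wreath_product_def finite_permutations finite_PiE)

lemma finite_partitions_of_type:
  assumes "\<alpha> \<in> G_compositions G n"
  shows "finite {P \<in> ordered_G_partitions G n. G_partition_type P = \<alpha>}"
  using bij_betw_finite[OF bij_betw_chamber_act_one[OF assms]] finite_wreath by simp

text \<open>
  The sets of elements with a given value of \<^const>\<open>Co\<close> are disjoint, and those with value
  below \<open>\<alpha>\<close> exhaust the elements that fit \<open>\<alpha>\<close>.
\<close>

lemma X_elem_eq_sum_fits: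
  assumes \<alpha>: "\<alpha> \<in> G_compositions G n"
  shows "X_elem G n \<alpha> = (\<Sum>u \<in> {u \<in> carrier wreath. fits_word (word u) \<alpha>}. frag_of u)"
proof -
  let ?C = "{u \<in> carrier wreath. fits_word (word u) \<alpha>}"
    and ?T = "{\<beta> \<in> G_compositions G n. G_comp_le \<beta> \<alpha>}"
  have C: "u \<in> ?C \<longleftrightarrow> u \<in> carrier wreath \<and> Co G n u \<in> ?T" for u
    using Co_eq_run_composition[of u] run_composition_in_G_compositions[OF word_in_words, of u]
      G_comp_le_run_composition_iff[OF \<alpha> word_in_words, of u] by auto
  have "(\<Sum>u \<in> ?C. frag_of u) = (\<Sum>\<beta> \<in> ?T. \<Sum>u \<in> {u \<in> ?C. Co G n u = \<beta>}. frag_of u)"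
    using C finite_G_compositions finite_wreath by (intro sum.group[symmetric]) auto
  also have "\<dots> = X_elem G n \<alpha>"
    unfolding X_elem_def Y_elem_def using C by (intro sum.cong) (auto intro!: sum.cong)
  finally show ?thesis by simp
qed

lemma invariant_carrier_iff:
  "x \<in> carrier inv_alg \<longleftrightarrow> Poly_Mapping.keys x \<subseteq> ordered_G_partitions G n \<and>
     (\<forall>\<pi>. \<pi> permutes {1..n} \<longrightarrow> frag_extend (\<lambda>P. frag_of (G_partition_act \<pi> P)) x = x)"
  by (simp add: invariant_algebra_def int_algebra_def G_partition_monoid_def)

lemma invariant_simps:
  "x \<otimes>\<^bsub>inv_alg\<^esub> y = frag_extend (\<lambda>P. frag_extend (\<lambda>Q. frag_of (G_partition_mult G P Q)) y) x"
  "\<one>\<^bsub>inv_alg\<^esub> = frag_of [({1..n}, \<one>)]"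
  "x \<oplus>\<^bsub>inv_alg\<^esub> y = x + y"
  by (simp_all add: invariant_algebra_def int_algebra_def G_partition_monoid_def)

lemma invariant_zero: "0 \<in> carrier inv_alg"
  by (simp add: invariant_carrier_iff)

lemma invariant_diff:
  assumes "x \<in> carrier inv_alg" "y \<in> carrier inv_alg" shows "x - y \<in> carrier inv_alg"
  using assms keys_diff[of x y] by (auto simp: invariant_carrier_iff frag_extend_diff)

lemma invariant_add:
  assumes "x \<in> carrier inv_alg" "y \<in> carrier inv_alg" shows "x + y \<in> carrier inv_alg"
  using assms keys_add[of x y] by (auto simp: invariant_carrier_iff frag_extend_add)

lemma invariant_one: "\<one>\<^bsub>inv_alg\<^esub> \<in> carrier inv_alg"
  using G_partition_one_closed[OF n_pos] permutes_image[of _ "{1..n}"]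
  by (auto simp: invariant_carrier_iff invariant_simps keys_frag_of G_partition_act_def)

lemma invariant_mult:
  assumes x: "x \<in> carrier inv_alg" and y: "y \<in> carrier inv_alg"
  shows "x \<otimes>\<^bsub>inv_alg\<^esub> y \<in> carrier inv_alg"
proof -
  have "x \<otimes>\<^bsub>inv_alg\<^esub> y = x \<otimes>\<^bsub>int_algebra (G_partition_monoid G n)\<^esub> y"
    by (simp add: invariant_algebra_def)
  moreover have "Poly_Mapping.keys (x \<otimes>\<^bsub>int_algebra (G_partition_monoid G n)\<^esub> y)
      \<subseteq> ordered_G_partitions G n"
    using x y by (intro keys_int_algebra_mult)
      (auto simp: invariant_carrier_iff G_partition_monoid_def intro: G_partition_mult_closed)
  moreover have "frag_extend (\<lambda>P. frag_of (G_partition_act \<pi> P)) (x \<otimes>\<^bsub>inv_alg\<^esub> y) = x \<otimes>\<^bsub>inv_alg\<^esub> y"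
    if \<pi>: "\<pi> permutes {1..n}" for \<pi>
  proof -
    let ?\<pi> = "frag_extend (\<lambda>P. frag_of (G_partition_act \<pi> P))"
    have "?\<pi> (x \<otimes>\<^bsub>inv_alg\<^esub> y) = ?\<pi> x \<otimes>\<^bsub>inv_alg\<^esub> ?\<pi> y"
      by (simp add: invariant_simps frag_extend_frag_extend G_partition_act_mult[OF permutes_inj[OF \<pi>]])
    then show ?thesis using x y \<pi> by (simp add: invariant_carrier_iff)
  qed
  ultimately show ?thesis by (simp add: invariant_carrier_iff)
qed

lemma sigma_elem_invariant:
  assumes \<alpha>: "\<alpha> \<in> G_compositions G n"
  shows "sigma_elem G n \<alpha> \<in> carrier inv_alg"
proof -
  let ?S = "{P \<in> ordered_G_partitions G n. G_partition_type P = \<alpha>}"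
  note fin = finite_partitions_of_type[OF \<alpha>]
  have "Poly_Mapping.keys (sigma_elem G n \<alpha>) \<subseteq> ?S"
    unfolding sigma_elem_def
    by (intro order_trans[OF keys_sum]) (auto simp: keys_frag_of)
  moreover have "frag_extend (\<lambda>P. frag_of (G_partition_act \<pi> P)) (sigma_elem G n \<alpha>) = sigma_elem G n \<alpha>"
    if \<pi>: "\<pi> permutes {1..n}" for \<pi>
  proof -
    have "bij_betw (G_partition_act \<pi>) ?S ?S"
      using G_partition_act_inverses[OF \<pi>] G_partition_act_closed \<pi> permutes_inv[OF \<pi>]
        G_partition_type_act[OF permutes_inj[OF \<pi>]]
        G_partition_type_act[OF permutes_inj[OF permutes_inv[OF \<pi>]]]
      by (intro bij_betw_byWitness[where f' = "G_partition_act (inv_into UNIV \<pi>)"]) auto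
    from sum.reindex_bij_betw[OF this, of frag_of] show ?thesis
      unfolding sigma_elem_def by (simp add: frag_extend_sum[OF fin] comp_def)
  qed
  ultimately show ?thesis by (auto simp: invariant_carrier_iff)
qed

lemma lookup_sigma_elem:
  assumes "\<alpha> \<in> G_compositions G n"
  shows "Poly_Mapping.lookup (sigma_elem G n \<alpha>) P =
    (if P \<in> ordered_G_partitions G n \<and> G_partition_type P = \<alpha> then 1 else 0)"
  unfolding sigma_elem_def using lookup_sum_frag_of[OF finite_partitions_of_type[OF assms]] by simp

lemma invariant_lookup_eq:
  assumes x: "x \<in> carrier inv_alg"
    and P: "P \<in> ordered_G_partitions G n" and Q: "Q \<in> ordered_G_partitions G n"
    and type: "G_partition_type P = G_partition_type Q"
  shows "Poly_Mapping.lookup x P = Poly_Mapping.lookup x Q"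
proof -
  obtain \<pi> where \<pi>: "\<pi> permutes {1..n}" and "G_partition_act \<pi> P = Q"
    using G_partition_act_transitive[OF P Q type] .
  then show ?thesis
    using lookup_frag_extend_inj[OF inj_G_partition_act[OF \<pi>], of x P] x
    by (simp add: invariant_carrier_iff)
qed

text \<open>
  The partitions of one type form one orbit of the symmetric group, so the coefficients of an invariant element
  depend on the type only. This gives the uniqueness of the map.
\<close>

lemma invariant_eq_sum_sigma_elem:
  assumes x: "x \<in> carrier inv_alg"
  obtains T c where "finite T" "T \<subseteq> G_compositions G n"
    "x = (\<Sum>\<alpha>\<in>T. frag_cmul (c \<alpha>) (sigma_elem G n \<alpha>))"
proof -
  let ?O = "ordered_G_partitions G n"
  define T where "T = G_partition_type ` Poly_Mapping.keys x"
  define c where "c = (\<lambda>\<alpha>. Poly_Mapping.lookup x (SOME P. P \<in> ?O \<and> G_partition_type P = \<alpha>))"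
  have keys: "Poly_Mapping.keys x \<subseteq> ?O" using x by (simp add: invariant_carrier_iff)
  have T: "finite T" "T \<subseteq> G_compositions G n"
    using keys G_partition_type_in_G_compositions by (auto simp: T_def)
  have c: "c (G_partition_type P) = Poly_Mapping.lookup x P" if "P \<in> ?O" for P
  proof -
    have "(SOME Q. Q \<in> ?O \<and> G_partition_type Q = G_partition_type P) \<in> ?O \<and>
        G_partition_type (SOME Q. Q \<in> ?O \<and> G_partition_type Q = G_partition_type P) = G_partition_type P"
      using that by (intro someI[of "\<lambda>Q. Q \<in> ?O \<and> G_partition_type Q = G_partition_type P" P]) simp
    then show ?thesis unfolding c_def using invariant_lookup_eq[OF x] that by blast
  qed
  have "x = (\<Sum>\<alpha>\<in>T. frag_cmul (c \<alpha>) (sigma_elem G n \<alpha>))"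
  proof (rule poly_mapping_eqI)
    fix P
    have "Poly_Mapping.lookup (\<Sum>\<alpha>\<in>T. frag_cmul (c \<alpha>) (sigma_elem G n \<alpha>)) P =
        (\<Sum>\<alpha>\<in>T. if P \<in> ?O \<and> G_partition_type P = \<alpha> then c \<alpha> else 0)"
      unfolding lookup_sum using T(2) by (intro sum.cong) (auto simp: lookup_sigma_elem)
    also have "\<dots> = Poly_Mapping.lookup x P"
    proof (cases "P \<in> ?O \<and> G_partition_type P \<in> T")
      case True
      then show ?thesis using T(1) c by simp
    next
      case False
      then have "P \<notin> Poly_Mapping.keys x" using keys by (auto simp: T_def)
      then have "Poly_Mapping.lookup x P = 0" by (simp add: in_keys_iff)
      moreover have "(\<Sum>\<alpha>\<in>T. if P \<in> ?O \<and> G_partition_type P = \<alpha> then c \<alpha> else 0) = 0"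
        using False by (intro sum.neutral) auto
      ultimately show ?thesis by simp
    qed
    finally show "Poly_Mapping.lookup x P =
        Poly_Mapping.lookup (\<Sum>\<alpha>\<in>T. frag_cmul (c \<alpha>) (sigma_elem G n \<alpha>)) P" by simp
  qed
  with T show ?thesis using that by blast
qed

section \<open>Evaluation at the identity chamber\<close>

text \<open>
  The value of the map is the product of \<open>x\<close> with the identity chamber.
\<close>

definition to_wreath where
  "to_wreath x = frag_extend (\<lambda>P. frag_of (chamber_act P \<one>\<^bsub>wreath\<^esub>)) x"

lemma to_wreath_closed:
  assumes "x \<in> carrier inv_alg" shows "to_wreath x \<in> carrier wreath_alg"
proof -
  have "Poly_Mapping.keys x \<subseteq> ordered_G_partitions G n"
    using assms by (simp add: invariant_carrier_iff)
  then have "Poly_Mapping.keys (to_wreath x) \<subseteq> carrier wreath"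
    unfolding to_wreath_def
    by (intro frag_extend_of_keys_subset chamber_act_closed wreath_one_closed) blast
  then show ?thesis by (simp add: int_algebra_simps)
qed

lemma to_wreath_add: "to_wreath (x + y) = to_wreath x + to_wreath y"
  by (simp add: to_wreath_def frag_extend_add)

lemma to_wreath_sigma_elem:
  assumes \<alpha>: "\<alpha> \<in> G_compositions G n"
  shows "to_wreath (sigma_elem G n \<alpha>) = X_elem G n \<alpha>"
  using sum.reindex_bij_betw[OF bij_betw_chamber_act_one[OF \<alpha>], of frag_of]
  unfolding to_wreath_def sigma_elem_def X_elem_eq_sum_fits[OF \<alpha>]
  by (simp add: frag_extend_sum[OF finite_partitions_of_type[OF \<alpha>]] comp_def)

lemma to_wreath_one: "to_wreath \<one>\<^bsub>inv_alg\<^esub> = \<one>\<^bsub>wreath_alg\<^esub>"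
  unfolding to_wreath_def invariant_simps int_algebra_simps frag_extend_of
    chamber_act_one[OF wreath_one_closed] ..

text \<open>
  An invariant element commutes with left multiplication by \<open>v\<close>: the renaming of letters
  that \<open>v\<close> causes in the partitions only permutes the terms of \<open>x\<close>.
\<close>

lemma invariant_translate:
  assumes x: "x \<in> carrier inv_alg" and v: "v \<in> carrier wreath"
  shows "frag_extend (\<lambda>P. frag_of (chamber_act P v)) x =
    frag_extend (\<lambda>P. frag_of (v \<otimes>\<^bsub>wreath\<^esub> chamber_act P \<one>\<^bsub>wreath\<^esub>)) x"
proof -
  have \<pi>: "fst v permutes {1..n}" using v by (simp add: wreath_carrier_iff)
  have "frag_extend (\<lambda>P. frag_of (chamber_act P v)) x =
      frag_extend (\<lambda>P. frag_of (chamber_act P v))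
        (frag_extend (\<lambda>P. frag_of (G_partition_act (fst v) P)) x)"
    using x \<pi> by (simp add: invariant_carrier_iff)
  also have "\<dots> = frag_extend (\<lambda>P. frag_of (chamber_act (G_partition_act (fst v) P) v)) x"
    by (simp add: frag_extend_frag_extend)
  also have "\<dots> = frag_extend (\<lambda>P. frag_of (v \<otimes>\<^bsub>wreath\<^esub> chamber_act P \<one>\<^bsub>wreath\<^esub>)) x"
  proof (rule frag_extend_eq)
    fix P assume "P \<in> Poly_Mapping.keys x"
    then have "P \<in> ordered_G_partitions G n" using x by (auto simp: invariant_carrier_iff)
    from chamber_act_equivariant[OF this v wreath_one_closed]
    show "frag_of (chamber_act (G_partition_act (fst v) P) v) =
        frag_of (v \<otimes>\<^bsub>wreath\<^esub> chamber_act P \<one>\<^bsub>wreath\<^esub>)"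
      by (simp add: wreath_r_one[OF v])
  qed
  finally show ?thesis .
qed

text \<open>
  With \<open>e\<close> the identity chamber, \<open>(xy)e = x(ye)\<close>. The chambers in \<open>ye\<close> have the
  form \<open>v * e\<close>, and \<open>x\<close> passes the factor \<open>v\<close>, which leaves
  \<open>ye * xe\<close>. The reversal of the factors comes from this exchange.
\<close>

lemma to_wreath_mult:
  assumes x: "x \<in> carrier inv_alg" and y: "y \<in> carrier inv_alg"
  shows "to_wreath (x \<otimes>\<^bsub>inv_alg\<^esub> y) = to_wreath y \<otimes>\<^bsub>wreath_alg\<^esub> to_wreath x"
proof -
  let ?e = "\<one>\<^bsub>wreath\<^esub>"
  have keys: "P \<in> ordered_G_partitions G n"
    if "P \<in> Poly_Mapping.keys x \<or> P \<in> Poly_Mapping.keys y" for P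
    using that x y by (auto simp: invariant_carrier_iff)
  have "to_wreath (x \<otimes>\<^bsub>inv_alg\<^esub> y) =
      frag_extend (\<lambda>P. frag_extend (\<lambda>Q. frag_of (chamber_act (G_partition_mult G P Q) ?e)) y) x"
    by (simp add: to_wreath_def invariant_simps frag_extend_frag_extend)
  also have "\<dots> = frag_extend (\<lambda>P. frag_extend (\<lambda>Q. frag_of (chamber_act P (chamber_act Q ?e))) y) x"
    using keys by (intro frag_extend_eq) (simp add: chamber_act_mult wreath_one_closed)
  also have "\<dots> = frag_extend (\<lambda>Q. frag_extend (\<lambda>P. frag_of (chamber_act P (chamber_act Q ?e))) x) y"
    by (rule frag_extend_swap)
  also have "\<dots> = frag_extend (\<lambda>Q. frag_extend
      (\<lambda>P. frag_of (chamber_act Q ?e \<otimes>\<^bsub>wreath\<^esub> chamber_act P ?e)) x) y"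
    using keys x
    by (intro frag_extend_eq invariant_translate) (auto intro: chamber_act_closed wreath_one_closed)
  also have "\<dots> = to_wreath y \<otimes>\<^bsub>wreath_alg\<^esub> to_wreath x"
    by (simp add: to_wreath_def int_algebra_simps frag_extend_frag_extend)
  finally show ?thesis .
qed

text \<open>
  Triangularity: let \<open>\<alpha>\<close> be a longest type in the support of \<open>x\<close>, and let \<open>u\<close>
  be an element with greedy composition \<open>\<alpha>\<close>. A partition of the support that contributes
  to \<open>u\<close> has a type refining \<open>\<alpha>\<close>, hence equal to \<open>\<alpha>\<close>, and there is only one
  such partition. So the coefficient at \<open>u\<close> is a nonzero coefficient of \<open>x\<close>.
\<close>

lemma to_wreath_eq_0:
  assumes x: "x \<in> carrier inv_alg" and zero: "to_wreath x = 0"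
  shows "x = 0"
proof (rule ccontr)
  let ?K = "Poly_Mapping.keys x"
  assume "x \<noteq> 0"
  then have K: "finite (length ` ?K)" "length ` ?K \<noteq> {}" by auto
  then obtain P where P: "P \<in> ?K" and "length P = Max (length ` ?K)"
    using Max_in[OF K] by (metis imageE)
  then have max: "length Q \<le> length P" if "Q \<in> ?K" for Q
    using Max_ge[OF K(1)] that by simp
  have OK: "Q \<in> ordered_G_partitions G n" if "Q \<in> ?K" for Q
    using that x by (auto simp: invariant_carrier_iff)
  define \<alpha> where "\<alpha> = G_partition_type P"
  let ?w = "descending_blocks_word \<alpha>"
  have \<alpha>: "\<alpha> \<in> G_compositions G n"
    using G_partition_type_in_G_compositions[OF OK[OF P]] by (simp add: \<alpha>_def)
  have w: "?w \<in> words"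
    using descending_blocks_word_letters[of \<alpha>] \<alpha> by (fastforce simp: words_def G_compositions_def)
  have run: "run_composition ?w = \<alpha>"
    using \<alpha> by (intro run_composition_descending_blocks_word) (auto simp: G_compositions_def)
  let ?u = "unword ?w" and ?P = "cut_word ?w \<alpha>"
  have u: "?u \<in> carrier wreath" "word ?u = ?w" using unword_in_wreath[OF w] word_unword[OF w] by auto
  have fits: "fits_word ?w \<alpha>" using fits_run_composition[of ?w] run by simp
  have P': "?P \<in> ordered_G_partitions G n" "partition_word ?P = ?w" "G_partition_type ?P = \<alpha>"
    using cut_word_in_ordered_G_partitions[OF \<alpha> w fits] partition_word_cut[OF fits]
      \<alpha> length_words[OF w] by (auto simp: G_compositions_def)
  have only: "Q = ?P" if Q: "Q \<in> ?K" and eq: "chamber_act Q \<one>\<^bsub>wreath\<^esub> = ?u" for Q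
  proof -
    have pw: "partition_word Q = ?w" using word_chamber_act_one[OF OK[OF Q]] eq u(2) by simp
    then have "fits_word ?w (G_partition_type Q)" using fits_partition_word[of Q] by simp
    then have "G_comp_le \<alpha> (G_partition_type Q)"
      using G_comp_le_run_composition_iff[OF G_partition_type_in_G_compositions[OF OK[OF Q]] w] run
      by simp
    then have "\<alpha> = G_partition_type Q"
      using G_comp_le_length[of \<alpha> "G_partition_type Q"] max[OF Q]
      by (simp add: \<alpha>_def G_partition_type_def)
    then show ?thesis using cut_partition_word_type[OF OK[OF Q]] pw by simp
  qed
  have "Poly_Mapping.lookup x ?P = Poly_Mapping.lookup x P"
    using invariant_lookup_eq[OF x P'(1) OK[OF P]] P'(3) by (simp add: \<alpha>_def)
  then have "Poly_Mapping.lookup x ?P \<noteq> 0" using P by (simp add: in_keys_iff)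
  have "word (chamber_act ?P \<one>\<^bsub>wreath\<^esub>) = ?w" using word_chamber_act_one[OF P'(1)] P'(2) by simp
  then have P'_u: "chamber_act ?P \<one>\<^bsub>wreath\<^esub> = ?u"
    using unword_word[OF chamber_act_closed[OF P'(1) wreath_one_closed]] by simp
  have "Poly_Mapping.lookup (to_wreath x) ?u =
      (\<Sum>Q \<in> ?K. Poly_Mapping.lookup x Q *
        Poly_Mapping.lookup (frag_of (chamber_act Q \<one>\<^bsub>wreath\<^esub>)) ?u)"
    by (simp only: to_wreath_def frag_extend_def lookup_sum lookup_frag_cmul)
  also have "\<dots> = (\<Sum>Q \<in> ?K. if Q = ?P then Poly_Mapping.lookup x ?P else 0)"
  proof (rule sum.cong[OF refl])
    fix Q assume "Q \<in> ?K"
    then have "?u = chamber_act Q \<one>\<^bsub>wreath\<^esub> \<longleftrightarrow> Q = ?P" using only[of Q] P'_u by metis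
    then have "Poly_Mapping.lookup (frag_of (chamber_act Q \<one>\<^bsub>wreath\<^esub>)) ?u = (if Q = ?P then 1 else 0)"
      unfolding lookup_frag_of by (simp only:)
    then show "Poly_Mapping.lookup x Q *
        Poly_Mapping.lookup (frag_of (chamber_act Q \<one>\<^bsub>wreath\<^esub>)) ?u =
        (if Q = ?P then Poly_Mapping.lookup x ?P else 0)"
      by (cases "Q = ?P") (simp_all only: if_True if_False mult_1_right mult_zero_right refl simp_thms)
  qed
  also have "\<dots> = Poly_Mapping.lookup x ?P"
    using \<open>Poly_Mapping.lookup x ?P \<noteq> 0\<close> by (simp only: sum.delta finite_keys in_keys_iff if_True not_False_eq_True)
  finally have "Poly_Mapping.lookup x ?P = 0" unfolding zero by (simp only: lookup_zero)
  then show False using \<open>Poly_Mapping.lookup x ?P \<noteq> 0\<close> by contradiction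
qed

lemma to_wreath_in_sigma_to_X_maps:
  "restrict to_wreath (carrier inv_alg) \<in> sigma_to_X_maps G n"
proof -
  have "restrict to_wreath (carrier inv_alg) \<in> hom (add_monoid inv_alg) (add_monoid wreath_alg)"
    using to_wreath_closed invariant_add
    by (intro homI) (simp_all add: invariant_simps(3) int_algebra_simps(4) to_wreath_add)
  then show ?thesis
    using to_wreath_sigma_elem sigma_elem_invariant by (simp add: sigma_to_X_maps_def)
qed

text \<open>
  The elements on which two such maps agree form an additive subgroup that contains all
  \<open>\<sigma>\<^sub>\<alpha>\<close>.
\<close>

lemma sigma_to_X_maps_unique:
  assumes f: "f \<in> sigma_to_X_maps G n" and h: "h \<in> sigma_to_X_maps G n"
  shows "f = h"
proof (rule extensionalityI[of f "carrier inv_alg"])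
  show "f \<in> extensional (carrier inv_alg)" "h \<in> extensional (carrier inv_alg)"
    using f h by (auto simp: sigma_to_X_maps_def)
  define agree where "agree = (\<lambda>x. x \<in> carrier inv_alg \<and> f x = h x)"
  have add: "k (x + y) = k x + k y"
    if "k \<in> sigma_to_X_maps G n" "x \<in> carrier inv_alg" "y \<in> carrier inv_alg" for k x y
    using that hom_mult[of k "add_monoid inv_alg" "add_monoid wreath_alg" x y]
    by (simp add: sigma_to_X_maps_def invariant_simps int_algebra_simps)
  have zero: "agree 0"
    using add[OF f invariant_zero invariant_zero] add[OF h invariant_zero invariant_zero]
    by (simp add: agree_def invariant_zero)
  have diff: "agree (x - y)" if "agree x" "agree y" for x y
    using that add[OF f invariant_diff[of x y], of y] add[OF h invariant_diff[of x y], of y]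
      invariant_diff[of x y] by (simp add: agree_def)
  have sum: "agree (\<Sum>\<alpha>\<in>T. frag_cmul (c \<alpha>) (sigma_elem G n \<alpha>))"
    if "finite T" "T \<subseteq> G_compositions G n" for T c
    using that
  proof (induction T)
    case empty
    then show ?case using zero by simp
  next
    case (insert \<alpha> T)
    have "agree (sigma_elem G n \<alpha>)"
      using insert.prems f h sigma_elem_invariant by (auto simp: agree_def sigma_to_X_maps_def)
    then have *: "agree (frag_cmul (c \<alpha>) (sigma_elem G n \<alpha>))"
      using frag_closure_minus_cmul[of agree] zero diff by blast
    have "agree (a + b)" if "agree a" "agree b" for a b
      using diff[OF that(1) diff[OF zero that(2)]] by simp
    with * insert show ?case by simp
  qed
  fix x assume x: "x \<in> carrier inv_alg"
  obtain T c where "finite T" "T \<subseteq> G_compositions G n"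
    "x = (\<Sum>\<alpha>\<in>T. frag_cmul (c \<alpha>) (sigma_elem G n \<alpha>))"
    using invariant_eq_sum_sigma_elem[OF x] .
  then show "f x = h x" using sum[of T c] by (simp add: agree_def)
qed

lemma to_wreath_inj: "inj_on to_wreath (carrier inv_alg)"
proof (rule inj_onI)
  fix x y assume "x \<in> carrier inv_alg" "y \<in> carrier inv_alg" "to_wreath x = to_wreath y"
  then have "x - y = 0"
    by (intro to_wreath_eq_0 invariant_diff) (simp_all add: to_wreath_def frag_extend_diff)
  then show "x = y" by simp
qed

lemma to_wreath_anti_hom:
  "restrict to_wreath (carrier inv_alg) \<in> ring_anti_hom inv_alg wreath_alg"
  unfolding ring_anti_hom_def mem_Collect_eq
proof (intro conjI allI impI)
  show "restrict to_wreath (carrier inv_alg) \<in> carrier inv_alg \<rightarrow> carrier wreath_alg"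
    using to_wreath_closed by simp
  show "restrict to_wreath (carrier inv_alg) \<one>\<^bsub>inv_alg\<^esub> = \<one>\<^bsub>wreath_alg\<^esub>"
    using invariant_one to_wreath_one by simp
  fix x y assume "x \<in> carrier inv_alg \<and> y \<in> carrier inv_alg"
  then have x: "x \<in> carrier inv_alg" and y: "y \<in> carrier inv_alg" by auto
  show "restrict to_wreath (carrier inv_alg) (x \<otimes>\<^bsub>inv_alg\<^esub> y) =
      restrict to_wreath (carrier inv_alg) y \<otimes>\<^bsub>wreath_alg\<^esub> restrict to_wreath (carrier inv_alg) x"
    using to_wreath_mult[OF x y] invariant_mult[OF x y] x y by simp
  show "restrict to_wreath (carrier inv_alg) (x \<oplus>\<^bsub>inv_alg\<^esub> y) =
      restrict to_wreath (carrier inv_alg) x \<oplus>\<^bsub>wreath_alg\<^esub> restrict to_wreath (carrier inv_alg) y"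
    using invariant_add[OF x y] x y
    by (simp add: invariant_simps(3) int_algebra_simps(4) to_wreath_add)
qed

end

theorem theorem1:
  fixes G :: "('g, 'm) monoid_scheme" and n :: nat
  assumes "group G" and "finite (carrier G)" and "n \<ge> 1"
  shows "(\<exists>!f. f \<in> sigma_to_X_maps G n) \<and>
         (\<forall>f \<in> sigma_to_X_maps G n.
            inj_on f (carrier (invariant_algebra G n)) \<and>
            f \<in> ring_anti_hom (invariant_algebra G n) (int_algebra (wreath_product G n)))"
proof -
  interpret group G by fact
  interpret finite_coloured_words G n using assms by unfold_locales
  let ?f = "restrict to_wreath (carrier inv_alg)"
  have f: "?f \<in> sigma_to_X_maps G n" by (rule to_wreath_in_sigma_to_X_maps)
  have "inj_on ?f (carrier inv_alg)" using to_wreath_inj by (simp add: inj_on_restrict_eq)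
  then show ?thesis using f sigma_to_X_maps_unique to_wreath_anti_hom by blast
qed

end
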